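(* Let $X$ be a separable Hilbert space with orthonormal basis $\{\varphi_k\}_{k\in\mathbb{N}}$, let $d \in \mathbb{N}$, $C_-, C_+ > 0$, and let $\{\alpha_k\}_{k\in\mathbb{N}}$ be a positive, non-decreasing sequence with $C_- k^{2/d} \le \alpha_k \le C_+ k^{2/d}$ for all $k \in \mathbb{N}$. Let $b, r > 0$ and $\beta, \tau > d/2$. For $u,y \in X$ let $$\Phi(u,y) = \sqrt{2}\sum_{k=1}^\infty \frac{|(y,\varphi_k)_X - e^{-\alpha_k}(u,\varphi_k)_X| - |(y,\varphi_k)_X|}{b\,\alpha_k^{-\beta/2}},$$ and let $\mu^y$ be the probability measure on $X$ with density $$\frac{\mathrm{d}\mu^y}{\mathrm{d}\mathcal{N}_{r^2A^{-\tau}}}(u) = \frac{1}{Z(y)}\exp(-\Phi(u,y)), \qquad Z(y) = \int_X \exp(-\Phi(u,y))\,\mathcal{N}_{r^2A^{-\tau}}(\mathrm{d}u).$$ Then for every $y \in X$, the functional $I^y: \mathcal{X}^\tau \to \mathbb{R}$ defined by $$I^y(u) = \Phi(u,y) + \frac{1}{2r^2}\|u\|_{\mathcal{X}^\tau}^2 = \frac{\sqrt{2}}{b}\sum_{k=1}^\infty \frac{|(y,\varphi_k)_X - e^{-\alpha_k}(u,\varphi_k)_X| - |(y,\varphi_k)_X|}{\alpha_k^{-\beta/2}} + \frac{1}{2r^2}\sum_{k=1}^\infty \frac{|(u,\varphi_k)_X|^2}{\alpha_k^{-\tau}}$$ is an Onsager--Machlup functional of $\mu^y$. It has a unique minimizer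 $\bar{u} = \bar{u}(y) \in \mathcal{X}^\tau$, which is the only (strong) mode of $\mu^y$ and is given by $$\bar{u} = \sum_{k=1}^\infty e^{\alpha_k} P_{\left[-\frac{r^2}{b}R_k, \frac{r^2}{b}R_k\right]}\big((y,\varphi_k)_X\big)\,\varphi_k, \qquad R_k := \sqrt{2}\,\alpha_k^{\frac{\beta}{2}-\tau}e^{-2\alpha_k},$$ where $P_J(x) := \arg\min_{z\in J}|z - x|$ denotes the projection of $x \in \mathbb{R}$ onto a closed interval $J \subseteq \mathbb{R}$.
   Context: $A$ is the unbounded operator $Ax = \sum_k \alpha_k(x,\varphi_k)_X\varphi_k$ on $\{x \in X: \sum_k \alpha_k^2|(x,\varphi_k)_X|^2 < \infty\}$, and powers are defined by $A^s x = \sum_k \alpha_k^s (x,\varphi_k)_X\varphi_k$. For $s \ge 0$, $\mathcal{X}^s = \{x \in X : \sum_k \alpha_k^s|(x,\varphi_k)_X|^2 < \infty\}$ with norm $\|x\|_{\mathcal{X}^s} = \|A^{s/2}x\|_X$. $\mathcal{N}_{r^2A^{-\tau}}$ is the centered Gaussian measure on $X$ with covariance operator $r^2A^{-\tau}$, which is trace class since $\tau > d/2$. $B_\varepsilon(x)$ denotes the open ball of radius $\varepsilon$ centred at $x$. Mode (strong mode): $\hat{x} \in X$ is a mode of a Borel probability measure $\mu$ on $X$ if $\lim_{\varepsilon \to 0} \frac{\mu(B_\varepsilon(\hat{x}))}{\sup_{x \in X}\mu(B_\varepsilon(x))} = 1$. Onsager--Machlup functional: let $E$ be the set of all $h \in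 X$ for which $\mu(\cdot - h)$ is equivalent to $\mu$. A functional $I: E \to \mathbb{R}$ is an Onsager--Machlup functional of $\mu$ if $\lim_{\varepsilon \to 0} \frac{\mu(B_\varepsilon(h_1))}{\mu(B_\varepsilon(h_2))} = \exp(I(h_2) - I(h_1))$ for all $h_1, h_2 \in E$. *)

theory Defs
  imports "HOL-Probability.Probability"
begin

text \<open>
  The Hilbert space \<open>X\<close> is a type of class \<open>{real_inner, polish_space}\<close>: a complete separable
  real inner product space. Sequences indexed by \<open>k = 1, 2, \<dots>\<close> in the mathematical text are
  indexed here from \<open>0\<close>, so that \<open>\<phi> k\<close> and \<open>\<alpha> k\<close> stand for the entries with number \<open>Suc k\<close>.
\<close>

definition orthonormal_basis :: "(nat \<Rightarrow> 'a::real_inner) \<Rightarrow> bool" where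
  "orthonormal_basis \<phi> \<longleftrightarrow>
     (\<forall>i j. \<phi> i \<bullet> \<phi> j = (if i = j then 1 else 0)) \<and> closure (span (range \<phi>)) = UNIV"

subsection \<open>The operator \<open>A\<close> and the spaces \<open>\<X>\<^sup>s\<close>\<close>

text \<open>
  \<open>A_pow \<phi> \<alpha> s x\<close> is \<open>A\<^sup>s x\<close>; it is meaningful where the series converges, that is
  on \<open>Xs \<phi> \<alpha> (2 * s)\<close>.
\<close>

definition A_pow :: "(nat \<Rightarrow> 'a::real_inner) \<Rightarrow> (nat \<Rightarrow> real) \<Rightarrow> real \<Rightarrow> 'a \<Rightarrow> 'a" where
  "A_pow \<phi> \<alpha> s x = (\<Sum>k. (\<alpha> k powr s * (x \<bullet> \<phi> k)) *\<^sub>R \<phi> k)"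

definition Xs :: "(nat \<Rightarrow> 'a::real_inner) \<Rightarrow> (nat \<Rightarrow> real) \<Rightarrow> real \<Rightarrow> 'a set" where
  "Xs \<phi> \<alpha> s = {x. summable (\<lambda>k. \<alpha> k powr s * \<bar>x \<bullet> \<phi> k\<bar>\<^sup>2)}"

definition Xs_norm :: "(nat \<Rightarrow> 'a::real_inner) \<Rightarrow> (nat \<Rightarrow> real) \<Rightarrow> real \<Rightarrow> 'a \<Rightarrow> real" where
  "Xs_norm \<phi> \<alpha> s x = norm (A_pow \<phi> \<alpha> (s / 2) x)"

subsection \<open>Gaussian measures on a Hilbert space\<close>

text \<open>The normal law with mean \<open>m\<close> and standard deviation \<open>\<sigma> \<ge> 0\<close>; a point mass if \<open>\<sigma> = 0\<close>.\<close>

definition normal_law :: "real \<Rightarrow> real \<Rightarrow> real measure" where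
  "normal_law m \<sigma> =
     (if \<sigma> = 0 then return borel m else density lborel (\<lambda>x. ennreal (normal_density m \<sigma> x)))"

definition gaussian_measure :: "'a::{real_inner, polish_space} measure \<Rightarrow> bool" where
  "gaussian_measure \<mu> \<longleftrightarrow> prob_space \<mu> \<and> sets \<mu> = sets borel \<and>
     (\<forall>h. \<exists>m \<sigma>. 0 \<le> \<sigma> \<and> distr \<mu> borel (\<lambda>x. x \<bullet> h) = normal_law m \<sigma>)"

text \<open>
  \<open>\<mu>\<close> is the Gaussian measure with mean \<open>0\<close> and covariance operator \<open>C\<close>. The one-dimensional
  marginals of a Gaussian measure have all moments, so the integrals below are proper ones.
\<close>

definition centered_gaussian ::
    "('a \<Rightarrow> 'a) \<Rightarrow> 'a::{real_inner, polish_space} measure \<Rightarrow> bool" where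
  "centered_gaussian C \<mu> \<longleftrightarrow> gaussian_measure \<mu> \<and>
     (\<forall>h. (LINT x|\<mu>. x \<bullet> h) = 0) \<and>
     (\<forall>h k. (LINT x|\<mu>. (x \<bullet> h) * (x \<bullet> k)) = C h \<bullet> k)"

subsection \<open>Modes and Onsager--Machlup functionals\<close>

definition strong_mode :: "'a::{real_inner, polish_space} measure \<Rightarrow> 'a \<Rightarrow> bool" where
  "strong_mode \<mu> x' \<longleftrightarrow>
     ((\<lambda>\<epsilon>. measure \<mu> (ball x' \<epsilon>) / (SUP x. measure \<mu> (ball x \<epsilon>))) \<longlongrightarrow> 1) (at_right 0)"

text \<open>The image of \<open>\<mu>\<close> under \<open>x \<mapsto> x + h\<close> is the measure \<open>B \<mapsto> \<mu> (B - h)\<close>.\<close>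

definition equivalent_shifts :: "'a::{real_inner, polish_space} measure \<Rightarrow> 'a set" where
  "equivalent_shifts \<mu> =
     {h. absolutely_continuous \<mu> (distr \<mu> borel (\<lambda>x. x + h)) \<and>
         absolutely_continuous (distr \<mu> borel (\<lambda>x. x + h)) \<mu>}"

text \<open>
  The functional is a total function \<open>I\<close> together with its domain \<open>E\<close>, which has to be
  the full set of admissible shifts.
\<close>

definition onsager_machlup ::
    "'a::{real_inner, polish_space} measure \<Rightarrow> 'a set \<Rightarrow> ('a \<Rightarrow> real) \<Rightarrow> bool" where
  "onsager_machlup \<mu> E I \<longleftrightarrow> E = equivalent_shifts \<mu> \<and>
     (\<forall>h1\<in>E. \<forall>h2\<in>E.
        ((\<lambda>\<epsilon>. measure \<mu> (ball h1 \<epsilon>) / measure \<mu> (ball h2 \<epsilon>))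
           \<longlongrightarrow> exp (I h2 - I h1)) (at_right 0))"

subsection \<open>The posterior measure and its functional\<close>

definition Phi ::
    "(nat \<Rightarrow> 'a::real_inner) \<Rightarrow> (nat \<Rightarrow> real) \<Rightarrow> real \<Rightarrow> real \<Rightarrow> 'a \<Rightarrow> 'a \<Rightarrow> real" where
  "Phi \<phi> \<alpha> b \<beta> u y =
     sqrt 2 * (\<Sum>k. (\<bar>y \<bullet> \<phi> k - exp (- \<alpha> k) * (u \<bullet> \<phi> k)\<bar> - \<bar>y \<bullet> \<phi> k\<bar>)
                     / (b * \<alpha> k powr (- \<beta> / 2)))"

definition Z_post ::
    "(nat \<Rightarrow> 'a::{real_inner, polish_space}) \<Rightarrow> (nat \<Rightarrow> real) \<Rightarrow> real \<Rightarrow> real \<Rightarrow> 'a measure \<Rightarrow>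
     'a \<Rightarrow> real" where
  "Z_post \<phi> \<alpha> b \<beta> \<mu>0 y = (LINT u|\<mu>0. exp (- Phi \<phi> \<alpha> b \<beta> u y))"

definition posterior ::
    "(nat \<Rightarrow> 'a::{real_inner, polish_space}) \<Rightarrow> (nat \<Rightarrow> real) \<Rightarrow> real \<Rightarrow> real \<Rightarrow> 'a measure \<Rightarrow>
     'a \<Rightarrow> 'a measure" where
  "posterior \<phi> \<alpha> b \<beta> \<mu>0 y =
     density \<mu>0 (\<lambda>u. ennreal (1 / Z_post \<phi> \<alpha> b \<beta> \<mu>0 y * exp (- Phi \<phi> \<alpha> b \<beta> u y)))"

definition I_post ::
    "(nat \<Rightarrow> 'a::real_inner) \<Rightarrow> (nat \<Rightarrow> real) \<Rightarrow> real \<Rightarrow> real \<Rightarrow> real \<Rightarrow> real \<Rightarrow> 'a \<Rightarrow> 'a \<Rightarrow> real" where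
  "I_post \<phi> \<alpha> b \<beta> r \<tau> y u =
     Phi \<phi> \<alpha> b \<beta> u y + 1 / (2 * r\<^sup>2) * (Xs_norm \<phi> \<alpha> \<tau> u)\<^sup>2"

definition R_thr :: "(nat \<Rightarrow> real) \<Rightarrow> real \<Rightarrow> real \<Rightarrow> nat \<Rightarrow> real" where
  "R_thr \<alpha> \<beta> \<tau> k = sqrt 2 * \<alpha> k powr (\<beta> / 2 - \<tau>) * exp (- 2 * \<alpha> k)"

end

theory Submission imports Defs begin

text \<open>
  In the coordinates of the basis the prior is a product of centred normal laws with variances
  \<open>\<nu> k\<close>, and \<open>\<Phi>\<close> is a sum of functions of one coordinate. Small balls of the prior
  are compared by two tools: the Cameron--Martin formula for shifts by \<open>C g\<close>, whose density is a
  continuous function of \<open>u \<bullet> g\<close>, and Anderson's inequality, by which removing a coordinate of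
  the centre does not decrease the measure of a ball. Anderson's inequality removes all but
  finitely many coordinates of the centre, the formula handles the rest, and this gives the
  Onsager--Machlup limit for the prior; since \<open>\<Phi>\<close> is Lipschitz, the posterior follows.

  The candidate mode \<open>u'\<close> has the form \<open>C g\<close>. Shifting the posterior by \<open>u'\<close> turns it into a
  constant times \<open>exp (- excess u)\<close> with respect to the centred prior, where
  \<open>0 \<le> excess u \<le> 2 * L * norm u\<close> because each projected coordinate minimises its summand of
  the functional. This bounds the normalising constant, and together with Anderson's inequality
  it bounds the ratio of the measures of any ball of radius \<open>\<epsilon>\<close> and that around \<open>u'\<close> by
  \<open>exp (2 * L * \<epsilon>)\<close>, with a strictly smaller limit if the centre is not \<open>u'\<close>.
\<close>

subsection \<open>Orthonormal bases\<close>

text \<open>The prior is known only through its one-dimensional marginals and its covariance, so its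
  symmetries and its shift formula have to be deduced from uniqueness of the characteristic
  functional. For a general Cameron--Martin vector \<open>h\<close> the density of the shift
  involves a measurable linear functional that is defined only up to null sets and gives no bounds
  on small balls; shifts by \<open>C g\<close> avoid this. Every \<open>trunc n h\<close> is such a
  shift, but the norm of its preimage may grow with \<open>n\<close>, so the truncation has to be
  fixed before the radius shrinks. The candidate mode lies in the range of \<open>C\<close> because
  the projection bounds the coordinates of its preimage by the weights \<open>c k\<close>, which are
  summable: in the application the factor \<open>exp (- \<alpha> k)\<close> beats every power of
  \<open>\<alpha> k\<close>. Anderson's inequality is needed for balls only, and their reflection
  symmetry in single coordinates replaces convexity arguments.\<close>

locale hilbert_basis =
  fixes \<phi> :: "nat \<Rightarrow> 'a::{real_inner, polish_space}"
  assumes basis: "orthonormal_basis \<phi>"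
begin

lemma inner_basis [simp]: "\<phi> i \<bullet> \<phi> j = (if i = j then 1 else 0)"
  using basis by (auto simp: orthonormal_basis_def)

lemma norm_basis [simp]: "norm (\<phi> i) = 1"
  by (simp add: norm_eq_sqrt_inner)

lemma abs_coord_le_norm: "\<bar>x \<bullet> \<phi> k\<bar> \<le> norm x"
  using Cauchy_Schwarz_ineq2[of x "\<phi> k"] by simp

lemma inner_lincomb:
  assumes "finite K"
  shows "(\<Sum>k\<in>K. a k *\<^sub>R \<phi> k) \<bullet> \<phi> j = (if j \<in> K then a j else 0)"
  using assms by (simp add: inner_sum_left if_distrib cong: if_cong)

lemma norm_lincomb:
  assumes "finite K"
  shows "(norm (\<Sum>k\<in>K. a k *\<^sub>R \<phi> k))\<^sup>2 = (\<Sum>k\<in>K. (a k)\<^sup>2)"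
proof -
  have "(norm (\<Sum>k\<in>K. a k *\<^sub>R \<phi> k))\<^sup>2 = (\<Sum>j\<in>K. a j * ((\<Sum>k\<in>K. a k *\<^sub>R \<phi> k) \<bullet> \<phi> j))"
    unfolding power2_norm_eq_inner inner_sum_right inner_scaleR_right ..
  also have "\<dots> = (\<Sum>j\<in>K. (a j)\<^sup>2)"
    using assms by (simp add: inner_lincomb power2_eq_square)
  finally show ?thesis .
qed

definition trunc :: "nat \<Rightarrow> 'a \<Rightarrow> 'a" where
  "trunc n x = (\<Sum>k<n. (x \<bullet> \<phi> k) *\<^sub>R \<phi> k)"

lemma trunc_coord: "trunc n x \<bullet> \<phi> j = (if j < n then x \<bullet> \<phi> j else 0)"
  by (simp add: trunc_def inner_lincomb)

lemma trunc_add: "trunc n (x + z) = trunc n x + trunc n z"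
  by (simp add: trunc_def inner_add_left scaleR_left_distrib sum.distrib)

lemma trunc_diff: "trunc n (x - z) = trunc n x - trunc n z"
  by (simp add: trunc_def inner_diff_left scaleR_left_diff_distrib sum_subtractf)

lemma trunc_scaleR: "trunc n (c *\<^sub>R x) = c *\<^sub>R trunc n x"
  by (simp add: trunc_def scaleR_sum_right)

lemma norm_trunc_le: "norm (trunc n x) \<le> norm x"
proof -
  have "(norm (trunc n x))\<^sup>2 = x \<bullet> trunc n x"
    by (simp add: trunc_def norm_lincomb inner_sum_right) (simp add: power2_eq_square)
  also have "\<dots> \<le> norm x * norm (trunc n x)"
    by (rule norm_cauchy_schwarz)
  finally have "norm (trunc n x) * norm (trunc n x) \<le> norm x * norm (trunc n x)"
    by (simp add: power2_eq_square)
  then show ?thesis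
    by (cases "norm (trunc n x) = 0") auto
qed

text \<open>Density of the span gives a finite combination \<open>p\<close> near \<open>x\<close>,
  and \<open>trunc n\<close> fixes \<open>p\<close> for large \<open>n\<close>. Since
  \<open>trunc n\<close> does not increase norms, the error is at most twice
  \<open>norm (x - p)\<close>.\<close>

lemma trunc_tendsto: "(\<lambda>n. trunc n x) \<longlonglongrightarrow> x"
proof (rule LIMSEQ_I)
  fix e :: real assume e: "e > 0"
  have "x \<in> closure (span (range \<phi>))"
    using basis by (simp add: orthonormal_basis_def)
  then obtain p where p: "p \<in> span (range \<phi>)" "dist p x < e / 2"
    using e by (meson closure_approachable half_gt_zero)
  have "\<exists>N. \<forall>n\<ge>N. trunc n p = p"
    using p(1)
  proof (induction rule: span_induct_alt)
    case base
    show ?case by (simp add: trunc_def)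
  next
    case (step c v z)
    then obtain k N where k: "v = \<phi> k" and N: "\<And>n. n \<ge> N \<Longrightarrow> trunc n z = z" by auto
    have "trunc n (\<phi> k) = \<phi> k" if "n > k" for n
      using that by (simp add: trunc_def if_distrib[of "\<lambda>c. c *\<^sub>R _"] cong: if_cong)
    then show ?case
      using k N by (intro exI[of _ "max N (Suc k)"]) (auto simp: trunc_add trunc_scaleR)
  qed
  then obtain N where N: "\<And>n. n \<ge> N \<Longrightarrow> trunc n p = p" by auto
  have "norm (trunc n x - x) < e" if "n \<ge> N" for n
  proof -
    have "trunc n x - x = trunc n (x - p) - (x - p)"
      using N[OF that] by (simp add: trunc_diff)
    then have "norm (trunc n x - x) \<le> norm (x - p) + norm (x - p)"
      using norm_triangle_ineq4[of "trunc n (x - p)" "x - p"] norm_trunc_le[of n "x - p"]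
      by (metis add_right_mono order_trans)
    then show ?thesis using p(2) by (simp add: dist_norm norm_minus_commute)
  qed
  then show "\<exists>N. \<forall>n\<ge>N. norm (trunc n x - x) < e" by blast
qed

lemma inner_sums: "(\<lambda>k. (x \<bullet> \<phi> k) * (z \<bullet> \<phi> k)) sums (x \<bullet> z)"
proof -
  have "(\<lambda>n. trunc n x \<bullet> z) \<longlonglongrightarrow> x \<bullet> z"
    by (intro tendsto_inner trunc_tendsto tendsto_const)
  then show ?thesis
    by (simp add: sums_def trunc_def inner_sum_left inner_commute[of "\<phi> _"])
qed

lemma parseval: "(\<lambda>k. (x \<bullet> \<phi> k)\<^sup>2) sums (norm x)\<^sup>2"
  using inner_sums[of x x] by (simp add: power2_eq_square flip: power2_norm_eq_inner)

lemma coord_eqI: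
  assumes "\<And>k. x \<bullet> \<phi> k = z \<bullet> \<phi> k"
  shows "x = z"
proof -
  have "trunc n x = trunc n z" for n
    using assms by (simp add: trunc_def)
  then show ?thesis
    using LIMSEQ_unique[OF trunc_tendsto[of x]] trunc_tendsto[of z] by simp
qed

text \<open>Completeness of the space enters here. The lemma later supplies the preimage of the mode
  and the values of \<open>A_pow\<close>, both prescribed coordinate by coordinate.\<close>

lemma riesz_fischer:
  assumes "summable (\<lambda>k. (a k)\<^sup>2)"
  shows "\<exists>x. (\<lambda>k. a k *\<^sub>R \<phi> k) sums x \<and> (\<forall>k. x \<bullet> \<phi> k = a k)"
proof -
  let ?S = "\<lambda>n. \<Sum>k<n. a k *\<^sub>R \<phi> k" and ?s = "\<lambda>n. \<Sum>k<n. (a k)\<^sup>2"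
  have diff: "(norm (?S n - ?S m))\<^sup>2 = \<bar>?s n - ?s m\<bar>" for m n
  proof (induction m n rule: linorder_wlog)
    case (le m n)
    have "?S n - ?S m = (\<Sum>k\<in>{m..<n}. a k *\<^sub>R \<phi> k)" "?s n - ?s m = (\<Sum>k\<in>{m..<n}. (a k)\<^sup>2)"
      using le sum_diff_nat_ivl[of 0 m n "\<lambda>k. a k *\<^sub>R \<phi> k"] sum_diff_nat_ivl[of 0 m n "\<lambda>k. (a k)\<^sup>2"]
      by (simp_all add: atLeast0LessThan)
    then show ?case by (simp add: norm_lincomb sum_nonneg)
  next
    case (sym m n)
    then show ?case by (simp add: norm_minus_commute abs_minus_commute)
  qed
  have "Cauchy ?S"
  proof (rule CauchyI)
    fix e :: real assume "e > 0"
    then have "e\<^sup>2 > 0" by simp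
    moreover have "Cauchy ?s"
      using assms by (simp add: summable_iff_convergent Cauchy_convergent_iff)
    ultimately obtain M where M: "\<And>m n. m \<ge> M \<Longrightarrow> n \<ge> M \<Longrightarrow> \<bar>?s m - ?s n\<bar> < e\<^sup>2"
      by (metis CauchyD real_norm_def)
    have "norm (?S m - ?S n) < e" if "m \<ge> M" "n \<ge> M" for m n
      using M[OF that] \<open>e > 0\<close> by (intro power2_less_imp_less[of _ e]) (auto simp: diff)
    then show "\<exists>M. \<forall>m\<ge>M. \<forall>n\<ge>M. norm (?S m - ?S n) < e" by blast
  qed
  then obtain x where x: "?S \<longlonglongrightarrow> x"
    using Cauchy_convergent_iff convergent_def by blast
  have "x \<bullet> \<phi> j = a j" for j
  proof -
    have "(\<lambda>n. ?S n \<bullet> \<phi> j) \<longlonglongrightarrow> x \<bullet> \<phi> j"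
      by (intro tendsto_inner x tendsto_const)
    moreover have "eventually (\<lambda>n. ?S n \<bullet> \<phi> j = a j) sequentially"
      using eventually_gt_at_top[of j] by eventually_elim (simp add: inner_lincomb)
    then have "(\<lambda>n. ?S n \<bullet> \<phi> j) \<longlonglongrightarrow> a j"
      by (rule tendsto_eventually)
    ultimately show ?thesis by (rule LIMSEQ_unique)
  qed
  then show ?thesis using x by (auto simp: sums_def)
qed

lemma sums_coord: "(\<lambda>k. (x \<bullet> \<phi> k) *\<^sub>R \<phi> k) sums x"
  using trunc_tendsto[of x] by (simp add: sums_def trunc_def)

end

subsection \<open>Uniqueness of the characteristic functional\<close>

text \<open>Reduction to \<open>Levy_uniqueness\<close> for probability laws: the total mass is
  \<open>char\<close> at \<open>0\<close>, hence common to both measures, and is divided out unless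
  it is \<open>0\<close>, when both vanish.\<close>

lemma char_eq_imp_eq:
  fixes M N :: "real measure"
  assumes "finite_measure M" "finite_measure N"
    and sets [measurable_cong]: "sets M = sets borel" "sets N = sets borel"
    and char: "\<And>t. char M t = char N t"
  shows "M = N"
proof -
  interpret M: finite_measure M by fact
  interpret N: finite_measure N by fact
  have space: "space M = UNIV" "space N = UNIV"
    using sets_eq_imp_space_eq[OF sets(1)] sets_eq_imp_space_eq[OF sets(2)] by auto
  define m where "m = measure M UNIV"
  have m: "measure N UNIV = m"
    using char[of 0] space by (simp add: char_def m_def)
  show ?thesis
  proof (cases "m = 0")
    case True
    show ?thesis
    proof (rule measure_eqI)
      show "emeasure M A = emeasure N A" if "A \<in> sets M" for A
        using M.finite_measure_mono[of A UNIV] N.finite_measure_mono[of A UNIV] that True m sets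
        by (simp add: M.emeasure_eq_measure N.emeasure_eq_measure m_def measure_le_0_iff)
    qed (simp add: sets)
  next
    case False
    then have pos: "m > 0"
      by (simp add: m_def zero_less_measure_iff)
    define normalized where "normalized L = density L (\<lambda>_. ennreal (1 / m))" for L :: "real measure"
    have real_dist: "real_distribution (normalized L)"
      if "finite_measure L" "sets L = sets borel" "measure L UNIV = m" for L
    proof -
      interpret L: finite_measure L by fact
      have sp: "space L = UNIV" using sets_eq_imp_space_eq[OF that(2)] by simp
      have "prob_space (normalized L)"
        using that pos sp
        by (intro prob_spaceI)
          (simp add: normalized_def emeasure_density nn_integral_cmult L.emeasure_eq_measure
            flip: ennreal_mult)
      then show ?thesis
        using that by (auto simp: real_distribution_def real_distribution_axioms_def normalized_def sp)
    qed
    have char_normalized: "char (normalized L) t = char L t / m"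
      if [measurable_cong]: "sets L = sets borel" for L t
    proof -
      have "char (normalized L) t = (CLINT x|L. (1 / m) *\<^sub>R iexp (t * x))"
        unfolding char_def normalized_def using pos by (subst integral_density) auto
      then show ?thesis by (simp add: char_def scaleR_conv_of_real divide_inverse mult.commute)
    qed
    have "normalized M = normalized N"
      using assms m
      by (intro Levy_uniqueness real_dist ext) (auto simp: char_normalized m_def)
    moreover have "emeasure L A = ennreal m * emeasure (normalized L) A"
      if [measurable]: "A \<in> sets L" for L A
    proof -
      have "ennreal m * emeasure (normalized L) A = ennreal m * (ennreal (1 / m) * emeasure L A)"
        unfolding normalized_def by (simp add: emeasure_density nn_integral_cmult)
      also have "\<dots> = emeasure L A"
        using pos by (simp add: mult.assoc[symmetric] flip: ennreal_mult)
      finally show ?thesis ..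
    qed
    ultimately show ?thesis
      using sets by (intro measure_eqI) auto
  qed
qed

context hilbert_basis
begin

section \<open>Cylinder sets in the coordinates of the basis\<close>

definition cyl :: "(nat \<Rightarrow> real set) \<Rightarrow> nat \<Rightarrow> 'a set" where
  "cyl A n = {x. \<forall>k<n. x \<bullet> \<phi> k \<in> A k}"

definition cyls :: "'a set set" where
  "cyls = {cyl A n |A n. \<forall>k. A k \<in> sets borel}"

lemma cyl_measurable:
  assumes "\<And>k. A k \<in> sets borel"
  shows "cyl A n \<in> sets borel"
proof -
  have "cyl A n = (\<Inter>k\<in>{..<n}. (\<lambda>x. x \<bullet> \<phi> k) -` A k) \<inter> UNIV"
    by (auto simp: cyl_def)
  moreover have "(\<lambda>x. x \<bullet> \<phi> k) -` A k \<in> sets borel" for k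
    using assms[of k] by (intro measurable_sets_borel[of _ borel]) auto
  ultimately show ?thesis
    by (cases n) (auto intro!: sets.finite_INT)
qed

lemma Int_stable_cyls: "Int_stable cyls"
proof (rule Int_stableI)
  fix S T assume "S \<in> cyls" "T \<in> cyls"
  then obtain A n B m where *: "S = cyl A n" "T = cyl B m" "\<And>k. A k \<in> sets borel" "\<And>k. B k \<in> sets borel"
    by (auto simp: cyls_def)
  have "S \<inter> T = cyl (\<lambda>k. (if k < n then A k else UNIV) \<inter> (if k < m then B k else UNIV)) (max n m)"
    unfolding * cyl_def by (auto simp: less_max_iff_disj)
  then show "S \<inter> T \<in> cyls"
    unfolding cyls_def using * by (auto intro!: exI sets.Int)
qed

text \<open>By Parseval, membership in a ball is a condition on a countable series of coordinates,
  so balls are measurable for the coordinate \<sigma>-algebra; by Lindelof every open set is a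
  countable union of balls.\<close>

lemma sigma_cyls: "sigma_sets UNIV cyls = sets (borel :: 'a measure)"
proof
  show "sigma_sets UNIV cyls \<subseteq> sets borel"
  proof
    fix S assume "S \<in> sigma_sets UNIV cyls"
    then show "S \<in> sets borel"
      by induction (auto simp: cyls_def intro: cyl_measurable sets.countable_UN)
  qed
  let ?\<Sigma> = "sigma UNIV cyls"
  have sets\<Sigma>: "sets ?\<Sigma> = sigma_sets UNIV cyls" by (simp add: sets_measure_of)
  have coord [measurable]: "(\<lambda>x. x \<bullet> \<phi> k) \<in> borel_measurable ?\<Sigma>" for k
  proof (rule measurableI)
    fix S :: "real set" assume S: "S \<in> sets borel"
    have "(\<lambda>x. x \<bullet> \<phi> k) -` S \<inter> space ?\<Sigma> = cyl (\<lambda>i. if i = k then S else UNIV) (Suc k)"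
      by (auto simp: cyl_def)
    moreover have "\<dots> \<in> cyls" using S by (auto simp: cyls_def)
    ultimately show "(\<lambda>x. x \<bullet> \<phi> k) -` S \<inter> space ?\<Sigma> \<in> sets ?\<Sigma>"
      by (simp add: sets\<Sigma>)
  qed simp
  have ball: "ball z e \<in> sets ?\<Sigma>" if "e > 0" for z e
  proof -
    have "norm (z - x) < e \<longleftrightarrow> (\<Sum>k. (z \<bullet> \<phi> k - x \<bullet> \<phi> k)\<^sup>2) < e\<^sup>2" for x
    proof -
      have "norm (z - x) < e \<longleftrightarrow> (norm (z - x))\<^sup>2 < e\<^sup>2"
        using that by (auto intro: power_strict_mono power2_less_imp_less)
      then show ?thesis
        using sums_unique[OF parseval[of "z - x"]] by (simp add: inner_diff_left)
    qed
    then have "ball z e = {x \<in> space ?\<Sigma>. (\<Sum>k. (z \<bullet> \<phi> k - x \<bullet> \<phi> k)\<^sup>2) < e\<^sup>2}"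
      unfolding ball_def dist_norm by (simp only: space_measure_of_conv UNIV_I simp_thms)
    also have "\<dots> \<in> sets ?\<Sigma>" by measurable
    finally show ?thesis .
  qed
  show "sets borel \<subseteq> sigma_sets UNIV cyls"
    unfolding borel_def
  proof (subst sets_measure_of, simp, rule sigma_sets_mono, rule subsetI)
    fix U :: "'a set" assume "U \<in> {S. open S}"
    then have U: "open U" by simp
    define F where "F = {ball z e |z e. e > 0 \<and> ball z e \<subseteq> U}"
    obtain F' where F': "F' \<subseteq> F" "countable F'" "\<Union>F' = \<Union>F"
      using Lindelof[of F] by (auto simp: F_def)
    have "\<Union>F = U"
      using U unfolding F_def open_contains_ball by (auto, metis centre_in_ball)
    moreover have "\<Union>F' \<in> sets ?\<Sigma>"
      using F'(1,2) ball by (intro sets.countable_Union) (auto simp: F_def)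
    ultimately show "U \<in> sigma_sets UNIV cyls"
      using F'(3) by (simp add: sets\<Sigma>)
  qed
qed

lemma integrable_cyl_cos:
  assumes "finite_measure M" and sets [measurable_cong]: "sets M = sets borel"
    and "\<And>k. A k \<in> sets borel"
  shows "integrable M (\<lambda>x. indicator (cyl A n) x * cos (x \<bullet> h + c) :: real)"
proof -
  interpret finite_measure M by fact
  have [measurable]: "cyl A n \<in> sets borel" by (intro cyl_measurable assms)
  show ?thesis
    by (intro integrable_const_bound[of _ 1]) (auto split: split_indicator)
qed

text \<open>
  Induction on the number of coordinates. The weights \<open>1 + cos (x \<bullet> h + c)\<close> are used because
  the uniqueness theorem for characteristic functions is only available for positive measures.
\<close>

lemma integral_cyl_cos_eq:
  assumes M: "finite_measure M" "sets M = sets borel"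
    and N: "finite_measure N" "sets N = sets borel"
    and eq: "\<And>h c. (LINT x|M. cos (x \<bullet> h + c)) = (LINT x|N. cos (x \<bullet> h + c))"
    and A: "\<And>k. A k \<in> sets borel"
  shows "(LINT x|M. indicator (cyl A n) x * cos (x \<bullet> h + c)) =
         (LINT x|N. indicator (cyl A n) x * cos (x \<bullet> h + c))"
proof (induction n arbitrary: h c)
  case 0
  then show ?case using eq by (simp add: cyl_def)
next
  case (Suc n)
  have cyl [measurable]: "cyl A n \<in> sets borel" by (intro cyl_measurable A)
  have Suc_eq: "(LINT x|M. indicator (cyl A (Suc n)) x * (1 + cos (x \<bullet> h + c))) =
     (LINT x|N. indicator (cyl A (Suc n)) x * (1 + cos (x \<bullet> h + c)))" for h c
  proof -
    let ?w = "\<lambda>x. indicator (cyl A n) x * (1 + cos (x \<bullet> h + c)) :: real"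
    have w0: "?w x \<ge> 0" for x
      using cos_ge_minus_one[of "x \<bullet> h + c"]
      by (intro mult_nonneg_nonneg) (simp, linarith)
    have w2: "?w x \<le> 2" for x
      using cos_le_one[of "x \<bullet> h + c"] by (simp split: split_indicator)
    \<comment> \<open>A product of two cosines is a sum of cosines, so every term has the form
      covered by the induction hypothesis, with other \<open>h\<close> and \<open>c\<close>.\<close>
    have expand: "?w x * cos (t * (x \<bullet> \<phi> n) + e) =
        indicator (cyl A n) x * cos (x \<bullet> (t *\<^sub>R \<phi> n) + e) +
        (1/2) * (indicator (cyl A n) x * cos (x \<bullet> (h + t *\<^sub>R \<phi> n) + (c + e))) +
        (1/2) * (indicator (cyl A n) x * cos (x \<bullet> (h - t *\<^sub>R \<phi> n) + (c - e)))" for x t e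
    proof -
      have "cos (x \<bullet> h + c) * cos (t * (x \<bullet> \<phi> n) + e) =
         (1/2) * cos (x \<bullet> (h + t *\<^sub>R \<phi> n) + (c + e)) + (1/2) * cos (x \<bullet> (h - t *\<^sub>R \<phi> n) + (c - e))"
        unfolding cos_times_cos by (simp add: inner_add_right inner_diff_right algebra_simps add_divide_distrib)
      then show ?thesis
        by (simp add: algebra_simps)
    qed
    have expand_integral: "(LINT x|L. ?w x * cos (t * (x \<bullet> \<phi> n) + e)) =
        (LINT x|L. indicator (cyl A n) x * cos (x \<bullet> (t *\<^sub>R \<phi> n) + e)) +
        (1/2) * (LINT x|L. indicator (cyl A n) x * cos (x \<bullet> (h + t *\<^sub>R \<phi> n) + (c + e))) +
        (1/2) * (LINT x|L. indicator (cyl A n) x * cos (x \<bullet> (h - t *\<^sub>R \<phi> n) + (c - e)))"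
      if L: "finite_measure L" "sets L = sets borel" for L t e
    proof -
      have int: "integrable L (\<lambda>x. indicator (cyl A n) x * cos (x \<bullet> h' + c') :: real)" for h' c'
        by (rule integrable_cyl_cos[OF L A])
      show ?thesis
        unfolding expand
        by (simp only: Bochner_Integration.integral_add Bochner_Integration.integrable_add int
            integrable_mult_right integral_mult_right_zero)
    qed
    have weighted: "(LINT x|M. ?w x * cos (t * (x \<bullet> \<phi> n) + e)) =
        (LINT x|N. ?w x * cos (t * (x \<bullet> \<phi> n) + e))" for t e
      by (simp only: expand_integral M N Suc.IH)
    define D where "D L = distr (density L (\<lambda>x. ennreal (?w x))) borel (\<lambda>x. x \<bullet> \<phi> n)" for L
    \<comment> \<open>Phase \<open>0\<close> gives the real part; phase \<open>- (pi / 2)\<close>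
      turns the cosine into the sine of the imaginary part.\<close>
    have char_D: "char (D L) t = Complex (LINT x|L. ?w x * cos (t * (x \<bullet> \<phi> n) + 0))
        (LINT x|L. ?w x * cos (t * (x \<bullet> \<phi> n) + - (pi / 2)))"
      if L: "finite_measure L" and [measurable_cong]: "sets L = sets borel" for L t
    proof -
      interpret L: finite_measure L by fact
      have "char (D L) t = (CLINT x|L. ?w x *\<^sub>R iexp (t * (x \<bullet> \<phi> n)))"
        unfolding char_def D_def using w0
        by (subst integral_distr) (auto intro!: integral_density)
      moreover have "integrable L (\<lambda>x. ?w x *\<^sub>R iexp (t * (x \<bullet> \<phi> n)))"
        using w0 w2 by (intro L.integrable_const_bound[of _ 2]) (auto simp: abs_of_nonneg)
      ultimately show ?thesis
        by (intro complex_eqI) (simp_all add: Re_exp Im_exp cos_diff flip: integral_Re integral_Im)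
    qed
    have finite_D: "finite_measure (D L)"
      if L: "finite_measure L" and [measurable_cong]: "sets L = sets borel" for L
    proof -
      interpret L: finite_measure L by fact
      have "integrable L ?w"
        using w0 w2 by (intro L.integrable_const_bound[of _ 2]) (auto simp: abs_of_nonneg)
      then have "(\<integral>\<^sup>+x. ?w x \<partial>L) < \<infinity>"
        using w0 by (subst nn_integral_eq_integral) auto
      then show ?thesis
        unfolding D_def
        by (intro finite_measure.finite_measure_distr finite_measureI) (auto simp: emeasure_density)
    qed
    have D_eq: "D M = D N"
    proof (intro char_eq_imp_eq finite_D M N)
      show "char (D M) t = char (D N) t" for t
        by (simp only: char_D M N weighted)
    qed (simp_all add: D_def)
    have measure_D: "measure (D L) (A n) = (LINT x|L. indicator (cyl A (Suc n)) x * (1 + cos (x \<bullet> h + c)))"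
      if L: "finite_measure L" and [measurable_cong]: "sets L = sets borel" for L
    proof -
      have [measurable]: "A n \<in> sets borel" by (rule A)
      have "measure (D L) (A n) = (LINT y|D L. indicator (A n) y)" by (simp add: D_def)
      also have "\<dots> = (LINT x|L. ?w x * indicator (A n) (x \<bullet> \<phi> n))"
        unfolding D_def using w0 by (subst integral_distr) (auto simp: integral_density)
      also have "\<dots> = (LINT x|L. indicator (cyl A (Suc n)) x * (1 + cos (x \<bullet> h + c)))"
        by (intro Bochner_Integration.integral_cong)
          (auto simp: cyl_def less_Suc_eq split: split_indicator)
      finally show ?thesis .
    qed
    show ?thesis using measure_D[OF M] measure_D[OF N] by (simp only: D_eq)
  qed
  have split: "(LINT x|L. indicator (cyl A (Suc n)) x * (1 + cos (x \<bullet> h + c))) =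
      (LINT x|L. indicator (cyl A (Suc n)) x) + (LINT x|L. indicator (cyl A (Suc n)) x * cos (x \<bullet> h + c))"
    if "finite_measure L" "sets L = sets borel" for L h c
  proof -
    have int: "integrable L (\<lambda>x. indicator (cyl A (Suc n)) x * cos (x \<bullet> h + c) :: real)" for h c
      by (rule integrable_cyl_cos[OF that A])
    show ?thesis
      using int[of h c] int[of 0 0]
      by (subst Bochner_Integration.integral_add[symmetric]) (simp_all add: distrib_left)
  qed
  \<comment> \<open>At \<open>h = 0\<close> and \<open>c = pi / 2\<close> the weight is constantly
    \<open>1\<close>. This isolates the plain indicator, which is subtracted from the weighted
    identity.\<close>
  show ?case
    using Suc_eq[of h c] Suc_eq[of 0 "pi / 2"] split[OF M] split[OF N] by simp
qed

text \<open>The arbitrary phase \<open>c\<close> lets cosines represent both parts of the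
  characteristic functional, so all integrals stay real.\<close>

lemma measure_eqI_cos:
  fixes M N :: "'a measure"
  assumes M: "finite_measure M" "sets M = sets borel"
    and N: "finite_measure N" "sets N = sets borel"
    and eq: "\<And>h c. (LINT x|M. cos (x \<bullet> h + c)) = (LINT x|N. cos (x \<bullet> h + c))"
  shows "M = N"
proof -
  interpret M: finite_measure M by fact
  interpret N: finite_measure N by fact
  show ?thesis
  proof (rule measure_eqI_generator_eq[OF Int_stable_cyls,
        where A = "\<lambda>_. UNIV"])
    show "sets M = sigma_sets UNIV cyls" "sets N = sigma_sets UNIV cyls"
      using M N by (auto simp: sigma_cyls)
    show "range (\<lambda>_::nat. UNIV :: 'a set) \<subseteq> cyls"
      unfolding cyls_def by (auto intro!: exI[of _ "\<lambda>_. UNIV"] exI[of _ 0] simp: cyl_def)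
    show "emeasure M S = emeasure N S" if "S \<in> cyls" for S
    proof -
      from that obtain A n where S: "S = cyl A n" and A: "\<And>k. A k \<in> sets borel"
        by (auto simp: cyls_def)
      have "S \<in> sets borel" unfolding S by (intro cyl_measurable A)
      then have "measure M S = measure N S"
        using integral_cyl_cos_eq[where n=n and A=A and h=0 and c=0, OF M N eq A] M N S
        by simp
      then show ?thesis by (simp add: M.emeasure_eq_measure N.emeasure_eq_measure)
    qed
  qed auto
qed

end

subsection \<open>The Cameron--Martin formula\<close>

text \<open>Affine images of the standard normal law cover point masses and densities alike, so
  later computations need no split on \<open>\<sigma> = 0\<close>.\<close>

lemma normal_law_eq_distr:
  assumes "\<sigma> \<ge> 0"
  shows "normal_law m \<sigma> = distr std_normal_distribution borel (\<lambda>x. m + \<sigma> * x)"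
proof (cases "\<sigma> = 0")
  case True
  interpret real_distribution std_normal_distribution
    by (rule real_dist_normal_dist)
  show ?thesis using True by (simp add: normal_law_def distr_const)
next
  case False
  then have pos: "\<sigma> > 0" using assms by simp
  show ?thesis
  proof (rule measure_eqI)
    fix A assume "A \<in> sets (normal_law m \<sigma>)"
    then have [measurable]: "A \<in> sets borel" using False by (simp add: normal_law_def)
    have dens: "\<sigma> * normal_density m \<sigma> (m + \<sigma> * x) = std_normal_density x" for x
      using pos by (simp add: normal_density_def real_sqrt_mult power_mult_distrib)
    have "emeasure (normal_law m \<sigma>) A = (\<integral>\<^sup>+x. ennreal (normal_density m \<sigma> x) * indicator A x \<partial>lborel)"
      using False by (simp add: normal_law_def emeasure_density)
    also have "\<dots> = (\<integral>\<^sup>+x. ennreal \<sigma> * (ennreal (normal_density m \<sigma> (m + \<sigma> * x)) * indicator A (m + \<sigma> * x)) \<partial>lborel)"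
      using pos by (subst nn_integral_real_affine[where c = \<sigma> and t = m]) (auto simp: nn_integral_cmult)
    also have "\<dots> = (\<integral>\<^sup>+x. ennreal (std_normal_density x) * indicator A (m + \<sigma> * x) \<partial>lborel)"
      using pos by (simp add: mult.assoc[symmetric] dens flip: ennreal_mult)
    also have "\<dots> = emeasure (distr std_normal_distribution borel (\<lambda>x. m + \<sigma> * x)) A"
      by (simp add: emeasure_distr emeasure_density indicator_vimage[symmetric] vimage_def
          flip: indicator_vimage)
    finally show "emeasure (normal_law m \<sigma>) A = emeasure (distr std_normal_distribution borel (\<lambda>x. m + \<sigma> * x)) A" .
  qed (simp add: normal_law_def)
qed

lemma integral_cos_std_normal:
  "(LINT s|std_normal_distribution. cos (t * s + c)) = cos c * exp (- t\<^sup>2 / 2)"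
proof -
  interpret real_distribution std_normal_distribution
    by (rule real_dist_normal_dist)
  have int: "integrable std_normal_distribution (\<lambda>s. cos (t * s))"
    "integrable std_normal_distribution (\<lambda>s. sin (t * s))"
    "integrable std_normal_distribution (\<lambda>s. iexp (t * s))"
    by (rule integrable_const_bound[of _ 1]; simp)+
  have "Complex (LINT s|std_normal_distribution. cos (t * s)) (LINT s|std_normal_distribution. sin (t * s))
      = char std_normal_distribution t"
    unfolding char_def using int by (intro complex_eqI) (simp_all add: Re_exp Im_exp flip: integral_Re integral_Im)
  also have "\<dots> = of_real (exp (- t\<^sup>2 / 2))"
    by (simp add: char_std_normal_distribution)
  finally have "(LINT s|std_normal_distribution. cos (t * s)) = exp (- t\<^sup>2 / 2)"
    "(LINT s|std_normal_distribution. sin (t * s)) = 0"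
    by (simp_all add: complex_eq_iff)
  then show ?thesis
    using int by (simp add: cos_add)
qed

lemma std_normal_moments:
  "(LINT s|std_normal_distribution. s) = 0" "(LINT s|std_normal_distribution. s\<^sup>2) = 1"
  "integrable std_normal_distribution (\<lambda>s. s)" "integrable std_normal_distribution (\<lambda>s. s\<^sup>2)"
  using integral_std_normal_distribution_moment_odd[of 1] std_normal_distribution_even_moments[of 1]
    integrable_std_normal_distribution_moment[of 1] integrable_std_normal_distribution_moment[of 2]
  by simp_all

text \<open>The marginal is the law of \<open>m + \<sigma> * s\<close> for some \<open>m\<close> and
  \<open>\<sigma>\<close>. The mean condition forces \<open>m = 0\<close>, and the diagonal of the
  covariance condition identifies the variance.\<close>

lemma centered_gaussian_distr:
  fixes C :: "'a::{real_inner, polish_space} \<Rightarrow> 'a"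
  assumes "centered_gaussian C \<mu>"
  shows "C h \<bullet> h \<ge> 0"
    and "distr \<mu> borel (\<lambda>x. x \<bullet> h) = distr std_normal_distribution borel (\<lambda>s. sqrt (C h \<bullet> h) * s)"
proof -
  have [measurable_cong]: "sets \<mu> = sets borel"
    using assms by (simp add: centered_gaussian_def gaussian_measure_def)
  interpret std: real_distribution std_normal_distribution
    by (rule real_dist_normal_dist)
  have "\<forall>h::'a. \<exists>m \<sigma>. 0 \<le> \<sigma> \<and> distr \<mu> borel (\<lambda>x. x \<bullet> h) = normal_law m \<sigma>"
    using assms unfolding centered_gaussian_def gaussian_measure_def by blast
  then obtain m \<sigma> where \<sigma>: "\<sigma> \<ge> 0" and "distr \<mu> borel (\<lambda>x. x \<bullet> h) = normal_law m \<sigma>"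
    by blast
  then have law: "distr \<mu> borel (\<lambda>x. x \<bullet> h) = distr std_normal_distribution borel (\<lambda>s. m + \<sigma> * s)"
    by (simp add: normal_law_eq_distr)
  have "0 = (LINT v|distr \<mu> borel (\<lambda>x. x \<bullet> h). v)"
    using assms by (subst integral_distr) (simp_all add: centered_gaussian_def)
  also have "\<dots> = (LINT s|std_normal_distribution. m + \<sigma> * s)"
    unfolding law by (subst integral_distr) simp_all
  also have "\<dots> = m"
    using std_normal_moments(1,3) std.prob_space by simp
  finally have m: "m = 0" by simp
  have "C h \<bullet> h = (LINT v|distr \<mu> borel (\<lambda>x. x \<bullet> h). v\<^sup>2)"
    using assms by (subst integral_distr) (simp_all add: centered_gaussian_def power2_eq_square)
  also have "\<dots> = (LINT s|std_normal_distribution. (\<sigma> * s)\<^sup>2)"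
    unfolding law m by (subst integral_distr) simp_all
  also have "\<dots> = \<sigma>\<^sup>2"
    using std_normal_moments(2) by (simp add: power_mult_distrib)
  finally have var: "C h \<bullet> h = \<sigma>\<^sup>2" .
  show "C h \<bullet> h \<ge> 0" by (simp add: var)
  show "distr \<mu> borel (\<lambda>x. x \<bullet> h) = distr std_normal_distribution borel (\<lambda>s. sqrt (C h \<bullet> h) * s)"
    using law m \<sigma> by (simp add: var)
qed

text \<open>\<open>C\<close> is a mere function pinned down by its coordinates; linearity and
  symmetry are consequences, and positivity of \<open>\<nu>\<close> makes its quadratic form
  definite.\<close>

locale diagonal_gaussian = hilbert_basis \<phi> for \<phi> :: "nat \<Rightarrow> 'a::{real_inner, polish_space}" +
  fixes C :: "'a \<Rightarrow> 'a" and \<nu> :: "nat \<Rightarrow> real" and \<mu> :: "'a measure"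
  assumes gaussian: "centered_gaussian C \<mu>"
    and C_coord: "\<And>h k. C h \<bullet> \<phi> k = \<nu> k * (h \<bullet> \<phi> k)"
    and \<nu>_pos: "\<And>k. \<nu> k > 0"
begin

sublocale prob_space \<mu>
  using gaussian by (simp add: centered_gaussian_def gaussian_measure_def)

lemma sets_\<mu> [measurable_cong, simp]: "sets \<mu> = sets borel"
  using gaussian by (simp add: centered_gaussian_def gaussian_measure_def)

lemma space_\<mu> [simp]: "space \<mu> = UNIV"
  using sets_eq_imp_space_eq[OF sets_\<mu>] by simp

lemma C_scaleR: "C (c *\<^sub>R g) = c *\<^sub>R C g"
  by (rule coord_eqI) (simp add: C_coord)

lemma C_diff: "C (g - h) = C g - C h"
  by (rule coord_eqI) (simp add: C_coord inner_diff_left algebra_simps)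

lemma C_inner_sums: "(\<lambda>k. \<nu> k * (g \<bullet> \<phi> k) * (h \<bullet> \<phi> k)) sums (C g \<bullet> h)"
  using inner_sums[of "C g" h] by (simp add: C_coord)

lemma C_sym: "C g \<bullet> h = C h \<bullet> g"
proof (rule sums_unique2[OF C_inner_sums])
  show "(\<lambda>k. \<nu> k * (g \<bullet> \<phi> k) * (h \<bullet> \<phi> k)) sums (C h \<bullet> g)"
    using C_inner_sums[of h g] by (simp only: mult.assoc mult.commute[of "h \<bullet> _"])
qed

lemma C_nonneg: "C g \<bullet> g \<ge> 0"
  by (rule centered_gaussian_distr[OF gaussian])

lemma C_inner_eq_0:
  assumes "C g \<bullet> g = 0"
  shows "g = 0"
proof (rule coord_eqI)
  fix k
  let ?f = "\<lambda>k. \<nu> k * (g \<bullet> \<phi> k)\<^sup>2"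
  have "?f sums 0"
    using C_inner_sums[of g g] assms by (simp add: power2_eq_square mult.assoc)
  then have "summable ?f" "suminf ?f = 0"
    by (auto simp: sums_iff)
  moreover have "?f n \<ge> 0" for n
    using \<nu>_pos[of n] by simp
  ultimately have "?f k = 0"
    using suminf_eq_zero_iff[of ?f] by blast
  then show "g \<bullet> \<phi> k = 0 \<bullet> \<phi> k"
    using \<nu>_pos[of k] by simp
qed

lemma integral_cos: "(LINT x|\<mu>. cos (x \<bullet> h + c)) = cos c * exp (- (C h \<bullet> h) / 2)"
proof -
  have "(LINT x|\<mu>. cos (x \<bullet> h + c)) = (LINT v|distr \<mu> borel (\<lambda>x. x \<bullet> h). cos (v + c))"
    by (simp add: integral_distr)
  also have "\<dots> = (LINT s|std_normal_distribution. cos (sqrt (C h \<bullet> h) * s + c))"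
    unfolding centered_gaussian_distr(2)[OF gaussian] by (simp add: integral_distr)
  finally show ?thesis
    by (simp add: integral_cos_std_normal C_nonneg)
qed

lemma eq_\<mu>I:
  assumes "finite_measure N" "sets N = sets borel"
    and "\<And>h c. (LINT x|N. cos (x \<bullet> h + c)) = cos c * exp (- (C h \<bullet> h) / 2)"
  shows "N = \<mu>"
  by (rule measure_eqI_cos[OF assms(1,2) finite_measure_axioms sets_\<mu>]) (simp only: assms(3) integral_cos)

text \<open>\<open>S\<close> is the adjoint of \<open>T\<close>. It preserves the quadratic form of
  \<open>C\<close>, hence \<open>T\<close> preserves the characteristic functional.\<close>

lemma distr_isometry:
  assumes [measurable]: "T \<in> borel_measurable borel"
    and "\<And>x h. T x \<bullet> h = x \<bullet> S h" "\<And>h. C (S h) \<bullet> S h = C h \<bullet> h"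
  shows "distr \<mu> borel T = \<mu>"
proof (rule eq_\<mu>I)
  fix h c
  have "(LINT x|(distr \<mu> borel T). cos (x \<bullet> h + c)) = (LINT x|\<mu>. cos (T x \<bullet> h + c))"
    by (subst integral_distr) simp_all
  then show "(LINT x|(distr \<mu> borel T). cos (x \<bullet> h + c)) = cos c * exp (- (C h \<bullet> h) / 2)"
    by (simp only: assms(2,3) integral_cos)
qed (simp_all add: finite_measure_distr)

lemma distr_uminus: "distr \<mu> borel (\<lambda>x. - x) = \<mu>"
proof (rule distr_isometry)
  show "(\<lambda>x::'a. - x) \<in> borel_measurable borel"
    by (intro borel_measurable_continuous_onI continuous_intros)
  have "C (- h) = - C h" for h
    by (rule coord_eqI) (simp add: C_coord)
  then show "C (- h) \<bullet> - h = C h \<bullet> h" for h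
    by simp
  show "- x \<bullet> h = x \<bullet> - h" for x h :: 'a
    by simp
qed

text \<open>\<open>\<phi> k\<close> is an eigenvector of \<open>C\<close>, so flipping the sign of
  its coordinate preserves the covariance form; the reflection is its own adjoint.\<close>

lemma distr_reflect: "distr \<mu> borel (\<lambda>x. x - (2 * (x \<bullet> \<phi> k)) *\<^sub>R \<phi> k) = \<mu>"
proof (rule distr_isometry[where S = "\<lambda>h. h - (2 * (h \<bullet> \<phi> k)) *\<^sub>R \<phi> k"])
  fix h :: 'a
  have "C (\<phi> k) \<bullet> h = \<nu> k * (h \<bullet> \<phi> k)" "C (\<phi> k) \<bullet> \<phi> k = \<nu> k"
    by (simp_all add: C_sym[of "\<phi> k"] C_coord)
  then show "C (h - (2 * (h \<bullet> \<phi> k)) *\<^sub>R \<phi> k) \<bullet> (h - (2 * (h \<bullet> \<phi> k)) *\<^sub>R \<phi> k) = C h \<bullet> h"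
    unfolding C_diff C_scaleR inner_diff_left inner_diff_right inner_scaleR_left inner_scaleR_right C_coord
    by simp
  show "(x - (2 * (x \<bullet> \<phi> k)) *\<^sub>R \<phi> k) \<bullet> h = x \<bullet> (h - (2 * (h \<bullet> \<phi> k)) *\<^sub>R \<phi> k)" for x
    by (simp add: inner_diff_left inner_diff_right inner_commute[of "\<phi> k" h])
  show "(\<lambda>x. x - (2 * (x \<bullet> \<phi> k)) *\<^sub>R \<phi> k) \<in> borel_measurable borel"
    by (intro borel_measurable_continuous_onI continuous_intros)
qed

text \<open>
  Splitting \<open>\<mu>\<close> along \<open>g\<close>: the coordinate \<open>x \<bullet> g\<close> is replaced by an independent copy.
\<close>

definition resample :: "'a \<Rightarrow> real \<times> 'a \<Rightarrow> 'a" where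
  "resample g = (\<lambda>(s, x). x + (s / sqrt (C g \<bullet> g) - (x \<bullet> g) / (C g \<bullet> g)) *\<^sub>R C g)"

lemma resample_measurable [measurable]:
  "resample g \<in> borel_measurable (std_normal_distribution \<Otimes>\<^sub>M \<mu>)"
  unfolding resample_def by measurable

lemma resample_inner:
  assumes "C g \<bullet> g > 0"
  shows "resample g (s, x) \<bullet> g = s * sqrt (C g \<bullet> g)"
proof -
  have "(s / sqrt (C g \<bullet> g)) * (C g \<bullet> g) = s * sqrt (C g \<bullet> g)"
    using assms real_div_sqrt[of "C g \<bullet> g"] by (simp add: times_divide_eq_right[symmetric])
  then show ?thesis
    using assms by (simp add: resample_def inner_add_left left_diff_distrib)
qed

text \<open>This is the point of \<open>resample\<close>: a shift by \<open>C g\<close> only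
  translates the scalar variable, which reduces the Cameron--Martin formula to the normal density on
  the line.\<close>

lemma resample_shift:
  assumes "C g \<bullet> g > 0"
  shows "resample g (s, x) + C g = resample g (s + sqrt (C g \<bullet> g), x)"
proof -
  have "resample g (s + sqrt (C g \<bullet> g), x) = x + ((s / sqrt (C g \<bullet> g) - (x \<bullet> g) / (C g \<bullet> g)) + 1) *\<^sub>R C g"
    using assms by (simp add: resample_def add_divide_distrib)
  then show ?thesis
    by (simp only: resample_def scaleR_left_distrib scaleR_one add.assoc prod.case)
qed

lemma distr_resample:
  assumes pos: "C g \<bullet> g > 0"
  shows "distr (std_normal_distribution \<Otimes>\<^sub>M \<mu>) borel (resample g) = \<mu>"
proof -
  interpret std: real_distribution std_normal_distribution
    by (rule real_dist_normal_dist)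
  interpret P: pair_prob_space std_normal_distribution \<mu> ..
  show ?thesis
  proof (rule eq_\<mu>I)
    fix h c
    \<comment> \<open>\<open>h'\<close> is \<open>h\<close> minus its projection onto
      \<open>g\<close> for the form of \<open>C\<close>, so \<open>x \<bullet> h'\<close> and
      \<open>x \<bullet> g\<close> are uncorrelated; the square of \<open>\<kappa>\<close> is the
      variance thereby removed.\<close>
    define \<kappa> where "\<kappa> = (C g \<bullet> h) / sqrt (C g \<bullet> g)"
    define h' where "h' = h - ((C g \<bullet> h) / (C g \<bullet> g)) *\<^sub>R g"
    have split: "resample g (s, x) \<bullet> h = x \<bullet> h' + \<kappa> * s" for s x
      by (simp add: resample_def \<kappa>_def h'_def inner_add_left inner_diff_right algebra_simps)
    have "C h' \<bullet> h' = C h \<bullet> h - (C g \<bullet> h)\<^sup>2 / (C g \<bullet> g)"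
      using pos by (simp add: h'_def C_diff C_scaleR inner_diff_left inner_diff_right
          C_sym[of h g] power2_eq_square field_simps)
    also have "(C g \<bullet> h)\<^sup>2 / (C g \<bullet> g) = \<kappa>\<^sup>2"
      using pos by (simp add: \<kappa>_def power_divide)
    finally have var: "C h' \<bullet> h' + \<kappa>\<^sup>2 = C h \<bullet> h" by simp
    have "(LINT x|(distr (std_normal_distribution \<Otimes>\<^sub>M \<mu>) borel (resample g)). cos (x \<bullet> h + c)) =
        (LINT p|(std_normal_distribution \<Otimes>\<^sub>M \<mu>). cos (resample g p \<bullet> h + c))"
      by (subst integral_distr) auto
    also have "\<dots> = (LINT x|\<mu>. (LINT s|std_normal_distribution. cos (resample g (s, x) \<bullet> h + c)))"
    proof -
      have "integrable (std_normal_distribution \<Otimes>\<^sub>M \<mu>) (\<lambda>p. cos (resample g p \<bullet> h + c))"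
        by (rule P.integrable_const_bound[of _ 1]) simp_all
      then show ?thesis
        using P.integral_snd[of "\<lambda>s x. cos (resample g (s, x) \<bullet> h + c)"] by (simp add: split_beta')
    qed
    also have "\<dots> = (LINT x|\<mu>. cos (x \<bullet> h' + c) * exp (- \<kappa>\<^sup>2 / 2))"
    proof (intro Bochner_Integration.integral_cong refl)
      fix x
      have "cos (resample g (s, x) \<bullet> h + c) = cos (\<kappa> * s + (x \<bullet> h' + c))" for s
        by (simp add: split add_ac)
      then show "(LINT s|std_normal_distribution. cos (resample g (s, x) \<bullet> h + c)) =
          cos (x \<bullet> h' + c) * exp (- \<kappa>\<^sup>2 / 2)"
        by (simp only: integral_cos_std_normal)
    qed
    also have "\<dots> = cos c * exp (- (C h \<bullet> h) / 2)"
      by (simp add: integral_cos flip: var exp_add add_divide_distrib)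
    finally show "(LINT x|(distr (std_normal_distribution \<Otimes>\<^sub>M \<mu>) borel (resample g)). cos (x \<bullet> h + c)) =
        cos c * exp (- (C h \<bullet> h) / 2)" .
  qed (auto intro!: P.finite_measure_distr)
qed

theorem cameron_martin:
  assumes [measurable]: "F \<in> borel_measurable borel"
  shows "(\<integral>\<^sup>+x. F (x + C g) \<partial>\<mu>) = (\<integral>\<^sup>+x. ennreal (exp (x \<bullet> g - (C g \<bullet> g) / 2)) * F x \<partial>\<mu>)"
proof (cases "C g \<bullet> g = 0")
  case True
  then have "g = 0" by (rule C_inner_eq_0)
  moreover have "C 0 = 0" using C_scaleR[of 0 0] by simp
  ultimately show ?thesis by simp
next
  case False
  then have pos: "C g \<bullet> g > 0" using C_nonneg[of g] by simp
  interpret std: real_distribution std_normal_distribution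
    by (rule real_dist_normal_dist)
  interpret P: pair_prob_space std_normal_distribution \<mu> ..
  let ?N = "std_normal_distribution"
  define \<sigma> where "\<sigma> = sqrt (C g \<bullet> g)"
  have \<sigma>: "\<sigma>\<^sup>2 = C g \<bullet> g" using pos by (simp add: \<sigma>_def)
  have split: "(\<integral>\<^sup>+x. G x \<partial>\<mu>) = (\<integral>\<^sup>+x. (\<integral>\<^sup>+s. G (resample g (s, x)) \<partial>?N) \<partial>\<mu>)"
    if [measurable]: "G \<in> borel_measurable borel" for G
  proof -
    have "(\<integral>\<^sup>+x. G x \<partial>\<mu>) = (\<integral>\<^sup>+p. G (resample g p) \<partial>(?N \<Otimes>\<^sub>M \<mu>))"
      by (subst distr_resample[OF pos, symmetric]) (simp add: nn_integral_distr)
    then show ?thesis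
      by (simp add: P.nn_integral_snd[symmetric])
  qed
  have "(\<integral>\<^sup>+s. F (resample g (s, x) + C g) \<partial>?N) =
     (\<integral>\<^sup>+s. ennreal (exp (resample g (s, x) \<bullet> g - (C g \<bullet> g) / 2)) * F (resample g (s, x)) \<partial>?N)" for x
  proof -
    have [measurable]: "(\<lambda>s. resample g (s, x)) \<in> borel_measurable borel"
      unfolding resample_def by simp
    \<comment> \<open>The quotient of the shifted and the unshifted density. By
      \<open>resample_inner\<close>, \<open>s * \<sigma>\<close> is the inner product with
      \<open>g\<close>, which yields the exponent of the claim.\<close>
    have dens: "std_normal_density (s - \<sigma>) = std_normal_density s * exp (s * \<sigma> - \<sigma>\<^sup>2 / 2)" for s
      by (simp add: std_normal_density_def power2_diff diff_divide_distrib add_divide_distrib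
          mult.assoc mult_exp_exp algebra_simps)
    have "(\<integral>\<^sup>+s. F (resample g (s, x) + C g) \<partial>?N) =
        (\<integral>\<^sup>+s. ennreal (std_normal_density s) * F (resample g (\<sigma> + s, x)) \<partial>lborel)"
      unfolding resample_shift[OF pos] \<sigma>_def by (simp add: nn_integral_density add.commute)
    also have "\<dots> = (\<integral>\<^sup>+s. ennreal (std_normal_density (s - \<sigma>)) * F (resample g (s, x)) \<partial>lborel)"
      by (subst (2) nn_integral_real_affine[where c = 1 and t = \<sigma>]) auto
    also have "\<dots> = (\<integral>\<^sup>+s. ennreal (exp (resample g (s, x) \<bullet> g - (C g \<bullet> g) / 2)) * F (resample g (s, x)) \<partial>?N)"
      by (simp add: nn_integral_density dens resample_inner[OF pos] ennreal_mult mult.assoc \<sigma> flip: \<sigma>_def)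
    finally show ?thesis .
  qed
  then show ?thesis
    by (subst (1 2) split) simp_all
qed

end

subsection \<open>Small balls\<close>

text \<open>An open ball is exhausted by balls of smaller radius. In the estimates below the gap
  \<open>e - e'\<close> absorbs the tail of a truncated centre.\<close>

lemma measure_ball_le:
  fixes x :: "'a::metric_space"
  assumes "finite_measure M" and [measurable_cong]: "sets M = sets borel"
    and "\<And>e'. e' < e \<Longrightarrow> measure M (ball x e') \<le> c"
  shows "measure M (ball x e) \<le> c"
proof -
  interpret finite_measure M by fact
  let ?B = "\<lambda>n. ball x (e - 1 / real (Suc n))"
  have "incseq ?B"
    by (intro incseq_SucI subset_ball) (simp add: frac_le)
  then have "(\<lambda>n. measure M (?B n)) \<longlonglongrightarrow> measure M (\<Union>n. ?B n)"
    by (intro finite_Lim_measure_incseq) (auto simp: assms(2))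
  moreover have "(\<Union>n. ?B n) = ball x e"
  proof
    show "ball x e \<subseteq> (\<Union>n. ?B n)"
    proof
      fix z assume "z \<in> ball x e"
      then obtain n where "inverse (real (Suc n)) < e - dist x z"
        using reals_Archimedean[of "e - dist x z"] by auto
      then have "z \<in> ?B n" by (simp add: inverse_eq_divide)
      then show "z \<in> (\<Union>n. ?B n)" by blast
    qed
  next
    show "(\<Union>n. ?B n) \<subseteq> ball x e"
      by (intro UN_least subset_ball) simp
  qed
  moreover have "measure M (?B n) \<le> c" for n
    by (intro assms(3)) simp
  ultimately show ?thesis
    by (auto intro: LIMSEQ_le_const2)
qed

context diagonal_gaussian
begin

lemma C_basis: "C (\<phi> k) = \<nu> k *\<^sub>R \<phi> k"
  by (rule coord_eqI) (simp add: C_coord)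

lemma cameron_martin_emeasure:
  assumes [measurable]: "A \<in> sets borel"
  shows "emeasure \<mu> {u. u + C g \<in> A} =
    (\<integral>\<^sup>+u. ennreal (exp (u \<bullet> g - (C g \<bullet> g) / 2)) * indicator A u \<partial>\<mu>)"
proof -
  have "{u. u + C g \<in> A} \<in> sets \<mu>"
    by measurable
  then have "emeasure \<mu> {u. u + C g \<in> A} = (\<integral>\<^sup>+u. indicator {u. u + C g \<in> A} u \<partial>\<mu>)"
    by (rule nn_integral_indicator[symmetric])
  also have "\<dots> = (\<integral>\<^sup>+u. indicator A (u + C g) \<partial>\<mu>)"
    by (simp add: indicator_def)
  finally have "emeasure \<mu> {u. u + C g \<in> A} = (\<integral>\<^sup>+u. indicator A (u + C g) \<partial>\<mu>)" .
  then show ?thesis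
    by (simp add: cameron_martin)
qed

lemma exp_inner_nn_integral: "(\<integral>\<^sup>+u. ennreal (exp (u \<bullet> g - (C g \<bullet> g) / 2)) \<partial>\<mu>) = 1"
  using cameron_martin[of "\<lambda>_. 1" g] emeasure_space_1 by simp

section \<open>Invariance under reflections and Anderson's inequality\<close>

lemma emeasure_uminus:
  assumes [measurable]: "A \<in> sets borel"
  shows "emeasure \<mu> {u. - u \<in> A} = emeasure \<mu> A"
  by (subst (2) distr_uminus[symmetric]) (simp add: emeasure_distr vimage_def)

lemma emeasure_reflect:
  assumes [measurable]: "A \<in> sets borel"
  shows "emeasure \<mu> {u. u - (2 * (u \<bullet> \<phi> k)) *\<^sub>R \<phi> k \<in> A} = emeasure \<mu> A"
  by (subst (2) distr_reflect[of k, symmetric]) (simp add: emeasure_distr vimage_def)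

lemma norm_reflect: "norm (w - (2 * (w \<bullet> \<phi> k)) *\<^sub>R \<phi> k) = norm w"
proof -
  have "(norm (w - (2 * (w \<bullet> \<phi> k)) *\<^sub>R \<phi> k))\<^sup>2 = (norm w)\<^sup>2"
    unfolding power2_norm_eq_inner
    by (simp add: inner_diff_left inner_diff_right inner_commute[of "\<phi> k" w])
  then show ?thesis by simp
qed

text \<open>
  Reflecting the \<open>k\<close>th coordinate at \<open>t / 2\<close> swaps the two balls, and on the part of the first
  that is not in the second the density of the shift by \<open>t *\<^sub>R \<phi> k\<close> is at least \<open>1\<close>.
\<close>

lemma anderson_coord:
  assumes x: "x \<bullet> \<phi> k = 0"
  shows "measure \<mu> (ball (x + t *\<^sub>R \<phi> k) e) \<le> measure \<mu> (ball x e)"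
proof -
  let ?A = "ball (x + t *\<^sub>R \<phi> k) e" and ?B = "ball x e"
  define g where "g = (t / \<nu> k) *\<^sub>R \<phi> k"
  have Cg: "C g = t *\<^sub>R \<phi> k"
    using \<nu>_pos[of k] by (simp add: g_def C_scaleR C_basis)
  have dens: "1 \<le> exp (u \<bullet> g - (C g \<bullet> g) / 2)" if "u \<in> ?A - ?B" for u
  proof -
    have "norm (u - x - t *\<^sub>R \<phi> k) < norm (u - x)"
      using that by (simp add: dist_norm norm_minus_commute algebra_simps)
    then have "(norm (u - x - t *\<^sub>R \<phi> k))\<^sup>2 < (norm (u - x))\<^sup>2"
      by (intro power_strict_mono) auto
    then have "t\<^sup>2 < 2 * t * (u \<bullet> \<phi> k)"
      unfolding power2_norm_eq_inner using x
      by (simp add: inner_diff_left inner_diff_right inner_commute[of "\<phi> k"] power2_eq_square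
          algebra_simps)
    then have "0 \<le> (2 * t * (u \<bullet> \<phi> k) - t\<^sup>2) / (2 * \<nu> k)"
      using \<nu>_pos[of k] by simp
    also have "\<dots> = u \<bullet> g - (C g \<bullet> g) / 2"
      unfolding Cg using \<nu>_pos[of k] by (simp add: g_def power2_eq_square field_simps)
    finally show ?thesis by simp
  qed
  have "emeasure \<mu> (?A - ?B) = (\<integral>\<^sup>+u. indicator (?A - ?B) u \<partial>\<mu>)"
    by simp
  also have "\<dots> \<le> (\<integral>\<^sup>+u. ennreal (exp (u \<bullet> g - (C g \<bullet> g) / 2)) * indicator (?A - ?B) u \<partial>\<mu>)"
    using dens by (intro nn_integral_mono) (simp split: split_indicator)
  also have "\<dots> = emeasure \<mu> {u. u + C g \<in> ?A - ?B}"
    by (rule cameron_martin_emeasure[symmetric]) measurable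
  also have "\<dots> = emeasure \<mu> {u. u + t *\<^sub>R \<phi> k \<in> ?A - ?B}"
    by (simp only: Cg)
  \<comment> \<open>The reflection at \<open>t / 2\<close> is composed of the reflection at
    \<open>0\<close>, which preserves \<open>\<mu>\<close>, and the shift by
    \<open>t *\<^sub>R \<phi> k\<close>.\<close>
  also have "\<dots> = emeasure \<mu> {u. u - (2 * (u \<bullet> \<phi> k)) *\<^sub>R \<phi> k \<in> {u. u + t *\<^sub>R \<phi> k \<in> ?A - ?B}}"
  proof (rule emeasure_reflect[symmetric])
    have "(\<lambda>u. u + t *\<^sub>R \<phi> k) -` (?A - ?B) \<in> sets borel"
      by (rule measurable_sets_borel[of _ borel]) simp_all
    then show "{u. u + t *\<^sub>R \<phi> k \<in> ?A - ?B} \<in> sets borel"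
      by (simp add: vimage_def)
  qed
  also have "{u. u - (2 * (u \<bullet> \<phi> k)) *\<^sub>R \<phi> k \<in> {u. u + t *\<^sub>R \<phi> k \<in> ?A - ?B}} = ?B - ?A"
  proof -
    have "norm (u - (2 * (u \<bullet> \<phi> k)) *\<^sub>R \<phi> k - x) = norm (u - x)"
      "norm (u - (2 * (u \<bullet> \<phi> k)) *\<^sub>R \<phi> k + t *\<^sub>R \<phi> k - x) = norm (u - (x + t *\<^sub>R \<phi> k))" for u
    proof -
      have "u - (2 * (u \<bullet> \<phi> k)) *\<^sub>R \<phi> k - x = (u - x) - (2 * ((u - x) \<bullet> \<phi> k)) *\<^sub>R \<phi> k"
        using x by (simp add: inner_diff_left)
      then show "norm (u - (2 * (u \<bullet> \<phi> k)) *\<^sub>R \<phi> k - x) = norm (u - x)"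
        by (simp only: norm_reflect)
      have "(u - (x + t *\<^sub>R \<phi> k)) \<bullet> \<phi> k = u \<bullet> \<phi> k - t"
        using x by (simp add: inner_diff_left inner_add_left)
      moreover have "(2 * (u \<bullet> \<phi> k - t)) *\<^sub>R \<phi> k = (2 * (u \<bullet> \<phi> k)) *\<^sub>R \<phi> k - (t *\<^sub>R \<phi> k + t *\<^sub>R \<phi> k)"
        by (simp only: right_diff_distrib scaleR_left_diff_distrib scaleR_left_distrib[symmetric] mult_2[of t])
      moreover have "a - b + c - x = (a - (x + c)) - (b - (c + c))" for a b c :: 'a
        by simp
      ultimately have "u - (2 * (u \<bullet> \<phi> k)) *\<^sub>R \<phi> k + t *\<^sub>R \<phi> k - x =
          (u - (x + t *\<^sub>R \<phi> k)) - (2 * ((u - (x + t *\<^sub>R \<phi> k)) \<bullet> \<phi> k)) *\<^sub>R \<phi> k"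
        by metis
      then show "norm (u - (2 * (u \<bullet> \<phi> k)) *\<^sub>R \<phi> k + t *\<^sub>R \<phi> k - x) = norm (u - (x + t *\<^sub>R \<phi> k))"
        by (simp only: norm_reflect)
    qed
    then show ?thesis
      by (auto simp: dist_norm norm_minus_commute)
  qed
  finally have "measure \<mu> (?A - ?B) \<le> measure \<mu> (?B - ?A)"
    by (simp add: emeasure_eq_measure)
  then show ?thesis
    using finite_measure_Diff'[of ?A ?B] finite_measure_Diff'[of ?B ?A] by (simp add: Int_commute)
qed

text \<open>Only finitely many coordinates can be removed one at a time, those with
  \<open>n \<le> k < m\<close>. The rest of the centre beyond \<open>m\<close> is small in norm and
  is paid for by enlarging the radius from \<open>e'\<close> to \<open>e\<close>.\<close>

lemma anderson_trunc: "measure \<mu> (ball x e) \<le> measure \<mu> (ball (trunc n x) e)"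
proof (rule measure_ball_le[OF finite_measure_axioms sets_\<mu>])
  fix e' :: real assume "e' < e"
  have step: "measure \<mu> (ball x e') \<le> measure \<mu> (ball (x - (trunc m x - trunc n x)) e')" if "m \<ge> n" for m
    using that
  proof (induction m rule: dec_induct)
    case base
    show ?case by simp
  next
    case (step m)
    let ?z = "x - (trunc (Suc m) x - trunc n x)"
    have z: "x - (trunc m x - trunc n x) = ?z + (x \<bullet> \<phi> m) *\<^sub>R \<phi> m"
      by (simp add: trunc_def)
    have "?z \<bullet> \<phi> m = 0"
      using step.hyps by (simp add: inner_diff_left trunc_coord)
    then have "measure \<mu> (ball (x - (trunc m x - trunc n x)) e') \<le> measure \<mu> (ball ?z e')"
      unfolding z by (rule anderson_coord)
    with step.IH show ?case by (rule order_trans)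
  qed
  have "eventually (\<lambda>m. norm (trunc m x - x) < e - e') sequentially"
    using trunc_tendsto[of x] \<open>e' < e\<close> by (auto simp: tendsto_iff dist_norm)
  then obtain m where m: "m \<ge> n" "norm (trunc m x - x) < e - e'"
    unfolding eventually_sequentially by (metis nle_le)
  have "ball (x - (trunc m x - trunc n x)) e' \<subseteq> ball (trunc n x) e"
  proof
    fix u assume "u \<in> ball (x - (trunc m x - trunc n x)) e'"
    moreover have "trunc n x - u = (x - (trunc m x - trunc n x) - u) + (trunc m x - x)" by simp
    ultimately show "u \<in> ball (trunc n x) e"
      using m(2) norm_triangle_ineq[of "x - (trunc m x - trunc n x) - u" "trunc m x - x"]
      by (simp add: dist_norm)
  qed
  then have "measure \<mu> (ball (x - (trunc m x - trunc n x)) e') \<le> measure \<mu> (ball (trunc n x) e)"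
    by (intro finite_measure_mono) auto
  with step[OF m(1)] show "measure \<mu> (ball x e') \<le> measure \<mu> (ball (trunc n x) e)" by simp
qed

lemma anderson: "measure \<mu> (ball x e) \<le> measure \<mu> (ball 0 e)"
  using anderson_trunc[of x e 0] by (simp add: trunc_def)

text \<open>Otherwise, by \<open>anderson\<close>, every ball of this radius would be null, and
  countably many of them cover the space.\<close>

lemma measure_ball_pos:
  assumes "e > 0"
  shows "measure \<mu> (ball 0 e) > 0"
proof (rule ccontr)
  assume "\<not> measure \<mu> (ball 0 e) > 0"
  then have null: "ball x e \<in> null_sets \<mu>" for x
    using anderson[of x e] by (simp add: null_sets_def emeasure_eq_measure measure_le_0_iff not_less)
  obtain \<B> where "\<B> \<subseteq> range (\<lambda>x::'a. ball x e)" "countable \<B>" "\<Union>\<B> = \<Union>(range (\<lambda>x::'a. ball x e))"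
    using Lindelof[of "range (\<lambda>x::'a. ball x e)"] by auto
  moreover have "\<Union>(range (\<lambda>x::'a. ball x e)) = UNIV"
    using assms by auto
  ultimately have "UNIV \<in> null_sets \<mu>"
    using null null_sets_UN'[of \<B> "\<lambda>B. B" \<mu>] by auto
  then show False
    using emeasure_space_1 by (simp add: null_sets_def)
qed

lemma C_uminus: "C (- g) = - C g"
  using C_scaleR[of "-1" g] by simp

section \<open>Prior balls centred in the range of \<open>C\<close>\<close>

lemma emeasure_ball_C:
  "emeasure \<mu> (ball (C g) e) =
    (\<integral>\<^sup>+u. ennreal (exp (- (u \<bullet> g) - (C g \<bullet> g) / 2)) * indicator (ball 0 e) u \<partial>\<mu>)"
proof -
  have eq: "ball (C g) e = {u. u + C (- g) \<in> ball 0 e}"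
    by (auto simp: C_uminus dist_norm norm_minus_commute)
  show ?thesis
    unfolding eq by (subst cameron_martin_emeasure) (simp_all add: C_uminus)
qed

lemma measure_ball_C_upper:
  "measure \<mu> (ball (C g) e) \<le> exp (e * norm g - (C g \<bullet> g) / 2) * measure \<mu> (ball 0 e)"
proof -
  have "emeasure \<mu> (ball (C g) e) \<le>
      (\<integral>\<^sup>+u. ennreal (exp (e * norm g - (C g \<bullet> g) / 2)) * indicator (ball 0 e) u \<partial>\<mu>)"
    unfolding emeasure_ball_C
  proof (intro nn_integral_mono)
    fix u
    have "- (u \<bullet> g) \<le> e * norm g" if "norm u < e"
    proof -
      have "norm u * norm g \<le> e * norm g"
        using that by (intro mult_right_mono) auto
      then show ?thesis
        using Cauchy_Schwarz_ineq2[of u g] by linarith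
    qed
    then show "ennreal (exp (- (u \<bullet> g) - (C g \<bullet> g) / 2)) * indicator (ball 0 e) u \<le>
        ennreal (exp (e * norm g - (C g \<bullet> g) / 2)) * indicator (ball 0 e) u"
      by (auto split: split_indicator)
  qed
  also have "\<dots> = ennreal (exp (e * norm g - (C g \<bullet> g) / 2)) * emeasure \<mu> (ball 0 e)"
    by (rule nn_integral_cmult_indicator) simp
  finally show ?thesis
    by (simp add: emeasure_eq_measure flip: ennreal_mult)
qed

text \<open>The balls around \<open>C g\<close> and \<open>C (- g)\<close> have equal measure, and
  averaging their formulas replaces \<open>exp (- (u \<bullet> g))\<close> by a hyperbolic cosine,
  which is at least \<open>1\<close>. Unlike the upper bound, this one has no factor with
  \<open>norm g\<close> and so survives growing truncations.\<close>

lemma measure_ball_C_lower: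
  "exp (- (C g \<bullet> g) / 2) * measure \<mu> (ball 0 e) \<le> measure \<mu> (ball (C g) e)"
proof -
  let ?c = "exp (- (C g \<bullet> g) / 2)"
  have [measurable]: "ball (0::'a) e \<in> sets borel" by simp
  have "emeasure \<mu> (ball (C (- g)) e) = emeasure \<mu> {u. - u \<in> ball (C g) e}"
    by (intro arg_cong[where f = "emeasure \<mu>"])
      (auto simp: C_uminus dist_norm norm_minus_commute add.commute)
  then have sym: "emeasure \<mu> (ball (C (- g)) e) = emeasure \<mu> (ball (C g) e)"
    using emeasure_uminus[of "ball (C g) e"] by simp
  have "ennreal (2 * ?c) * emeasure \<mu> (ball 0 e) =
      (\<integral>\<^sup>+u. ennreal (2 * ?c) * indicator (ball 0 e) u \<partial>\<mu>)"
    by (rule nn_integral_cmult_indicator[symmetric]) simp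
  also have "\<dots> \<le> (\<integral>\<^sup>+u. ennreal (exp (- (u \<bullet> g) - (C g \<bullet> g) / 2)) * indicator (ball 0 e) u +
      ennreal (exp (- (u \<bullet> (- g)) - (C (- g) \<bullet> (- g)) / 2)) * indicator (ball 0 e) u \<partial>\<mu>)"
  proof (intro nn_integral_mono)
    fix u
    have "2 * ?c \<le> (exp (- (u \<bullet> g)) + exp (u \<bullet> g)) * ?c"
      using exp_ge_add_one_self[of "u \<bullet> g"] exp_ge_add_one_self[of "- (u \<bullet> g)"]
      by (intro mult_right_mono) (linarith, simp)
    then have "2 * ?c \<le> exp (- (u \<bullet> g) - (C g \<bullet> g) / 2) + exp (u \<bullet> g - (C g \<bullet> g) / 2)"
      by (simp add: distrib_right mult_exp_exp)
    then have "ennreal (2 * ?c) \<le> ennreal (exp (- (u \<bullet> g) - (C g \<bullet> g) / 2) + exp (u \<bullet> g - (C g \<bullet> g) / 2))"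
      by (rule ennreal_leI)
    also have "\<dots> = ennreal (exp (- (u \<bullet> g) - (C g \<bullet> g) / 2)) + ennreal (exp (u \<bullet> g - (C g \<bullet> g) / 2))"
      by (rule ennreal_plus) simp_all
    finally show "ennreal (2 * ?c) * indicator (ball 0 e) u \<le>
        ennreal (exp (- (u \<bullet> g) - (C g \<bullet> g) / 2)) * indicator (ball 0 e) u +
        ennreal (exp (- (u \<bullet> (- g)) - (C (- g) \<bullet> (- g)) / 2)) * indicator (ball 0 e) u"
      by (cases "u \<in> ball 0 e") (simp_all add: C_uminus del: mem_ball_0 mem_ball)
  qed
  also have "\<dots> = emeasure \<mu> (ball (C g) e) + emeasure \<mu> (ball (C (- g)) e)"
    unfolding emeasure_ball_C by (rule nn_integral_add) measurable
  finally have "ennreal (2 * ?c * measure \<mu> (ball 0 e)) \<le>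
      ennreal (measure \<mu> (ball (C g) e) + measure \<mu> (ball (C g) e))"
    unfolding sym unfolding emeasure_eq_measure
    by (subst ennreal_mult, simp, simp, subst ennreal_plus) simp_all
  then have "2 * ?c * measure \<mu> (ball 0 e) \<le> measure \<mu> (ball (C g) e) + measure \<mu> (ball (C g) e)"
    by (subst (asm) ennreal_le_iff) simp_all
  then show ?thesis by simp
qed

text \<open>The solution of \<open>C g = trunc n h\<close>. The vector \<open>h\<close> itself need
  not have a preimage, even if it is a Cameron--Martin vector.\<close>

definition preimage :: "nat \<Rightarrow> 'a \<Rightarrow> 'a" where
  "preimage n h = (\<Sum>k<n. ((h \<bullet> \<phi> k) / \<nu> k) *\<^sub>R \<phi> k)"

lemma C_preimage: "C (preimage n h) = trunc n h"
proof (rule coord_eqI)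
  show "C (preimage n h) \<bullet> \<phi> k = trunc n h \<bullet> \<phi> k" for k
    using \<nu>_pos[of k] by (simp add: C_coord preimage_def inner_lincomb trunc_coord)
qed

lemma inner_preimage: "h \<bullet> preimage n h = (\<Sum>k<n. (h \<bullet> \<phi> k)\<^sup>2 / \<nu> k)"
  by (simp add: preimage_def inner_sum_right power2_eq_square)

lemma C_preimage_inner: "C (preimage n h) \<bullet> preimage n h = (\<Sum>k<n. (h \<bullet> \<phi> k)\<^sup>2 / \<nu> k)"
proof -
  have "C (preimage n h) \<bullet> preimage n h = (\<Sum>k<n. (trunc n h \<bullet> \<phi> k) * (h \<bullet> \<phi> k) / \<nu> k)"
    unfolding C_preimage by (simp add: preimage_def inner_sum_right mult.commute)
  then show ?thesis
    by (simp add: trunc_coord power2_eq_square)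
qed

text \<open>Anderson's inequality discards the coordinates from \<open>n\<close> on, so the centre
  \<open>h\<close> is arbitrary. This generality later excludes modes outside the Cameron--Martin
  space.\<close>

lemma measure_ball_upper:
  "measure \<mu> (ball h e) \<le>
    exp (e * norm (preimage n h) - (\<Sum>k<n. (h \<bullet> \<phi> k)\<^sup>2 / \<nu> k) / 2) * measure \<mu> (ball 0 e)"
  using anderson_trunc[of h e n] measure_ball_C_upper[of "preimage n h" e]
  by (simp add: C_preimage_inner) (simp add: C_preimage)

text \<open>Truncated centres satisfy the bound with the full series, because partial sums are
  smaller. A slightly smaller ball around \<open>trunc n h\<close> lies in the ball around
  \<open>h\<close>.\<close>

lemma measure_ball_lower:
  assumes "summable (\<lambda>k. (h \<bullet> \<phi> k)\<^sup>2 / \<nu> k)"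
  shows "exp (- (\<Sum>k. (h \<bullet> \<phi> k)\<^sup>2 / \<nu> k) / 2) * measure \<mu> (ball 0 e) \<le> measure \<mu> (ball h e)"
proof -
  let ?S = "\<Sum>k. (h \<bullet> \<phi> k)\<^sup>2 / \<nu> k"
  have "measure \<mu> (ball 0 e) \<le> exp (?S / 2) * measure \<mu> (ball h e)"
  proof (rule measure_ball_le[OF finite_measure_axioms sets_\<mu>])
    fix e' :: real assume "e' < e"
    then have "eventually (\<lambda>n. norm (trunc n h - h) < e - e') sequentially"
      using trunc_tendsto[of h] by (auto simp: tendsto_iff dist_norm)
    then obtain n where n: "norm (trunc n h - h) < e - e'"
      unfolding eventually_sequentially by blast
    have "ball (trunc n h) e' \<subseteq> ball h e"
    proof
      fix u assume "u \<in> ball (trunc n h) e'"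
      moreover have "h - u = (trunc n h - u) + (h - trunc n h)" by simp
      ultimately show "u \<in> ball h e"
        using n norm_triangle_ineq[of "trunc n h - u" "h - trunc n h"]
        by (simp add: dist_norm norm_minus_commute)
    qed
    then have "measure \<mu> (ball (trunc n h) e') \<le> measure \<mu> (ball h e)"
      by (intro finite_measure_mono) auto
    moreover have "exp (- ?S / 2) * measure \<mu> (ball 0 e') \<le>
        exp (- (C (preimage n h) \<bullet> preimage n h) / 2) * measure \<mu> (ball 0 e')"
      unfolding C_preimage_inner using assms \<nu>_pos
      by (intro mult_right_mono) (auto intro!: sum_le_suminf simp: less_imp_le)
    moreover have "\<dots> \<le> measure \<mu> (ball (trunc n h) e')"
      using measure_ball_C_lower[of "preimage n h" e'] unfolding C_preimage .
    ultimately have "exp (- ?S / 2) * measure \<mu> (ball 0 e') \<le> measure \<mu> (ball h e)"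
      by linarith
    then show "measure \<mu> (ball 0 e') \<le> exp (?S / 2) * measure \<mu> (ball h e)"
      by (simp add: exp_minus field_simps)
  qed
  then show ?thesis
    by (simp add: exp_minus field_simps)
qed

text \<open>The lower bound holds at every radius. For the upper bound \<open>n\<close> is chosen
  first, so that the truncated exponential is below \<open>a\<close>; then the radius shrinks and
  removes the term with \<open>norm (preimage n h)\<close>.\<close>

theorem ball_ratio_tendsto:
  assumes "summable (\<lambda>k. (h \<bullet> \<phi> k)\<^sup>2 / \<nu> k)"
  shows "((\<lambda>e. measure \<mu> (ball h e) / measure \<mu> (ball 0 e)) \<longlongrightarrow>
    exp (- (\<Sum>k. (h \<bullet> \<phi> k)\<^sup>2 / \<nu> k) / 2)) (at_right 0)"
proof (rule order_tendstoI)
  let ?S = "\<Sum>k. (h \<bullet> \<phi> k)\<^sup>2 / \<nu> k"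
  have pos: "eventually (\<lambda>e::real. e > 0) (at_right 0)"
    by (simp add: eventually_at_right_less)
  {
    fix a assume a: "a < exp (- ?S / 2)"
    show "eventually (\<lambda>e. a < measure \<mu> (ball h e) / measure \<mu> (ball 0 e)) (at_right 0)"
      using pos
    proof eventually_elim
      case (elim e)
      then have "exp (- ?S / 2) \<le> measure \<mu> (ball h e) / measure \<mu> (ball 0 e)"
        using measure_ball_lower[OF assms, of e] measure_ball_pos[of e] by (simp add: field_simps)
      with a show ?case by linarith
    qed
  next
    fix a assume a: "exp (- ?S / 2) < a"
    have "(\<lambda>n. exp (- (\<Sum>k<n. (h \<bullet> \<phi> k)\<^sup>2 / \<nu> k) / 2)) \<longlonglongrightarrow> exp (- ?S / 2)"
      by (intro tendsto_intros summable_LIMSEQ assms) simp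
    then have "eventually (\<lambda>n. exp (- (\<Sum>k<n. (h \<bullet> \<phi> k)\<^sup>2 / \<nu> k) / 2) < a) sequentially"
      using a by (rule order_tendstoD)
    then obtain n where n: "exp (- (\<Sum>k<n. (h \<bullet> \<phi> k)\<^sup>2 / \<nu> k) / 2) < a"
      unfolding eventually_sequentially by blast
    let ?s = "\<Sum>k<n. (h \<bullet> \<phi> k)\<^sup>2 / \<nu> k"
    have "((\<lambda>e. exp (e * norm (preimage n h) - ?s / 2)) \<longlongrightarrow> exp (0 * norm (preimage n h) - ?s / 2)) (at_right 0)"
      by (intro tendsto_intros)
    then have "eventually (\<lambda>e. exp (e * norm (preimage n h) - ?s / 2) < a) (at_right 0)"
      by (rule order_tendstoD) (use n in simp)
    then show "eventually (\<lambda>e. measure \<mu> (ball h e) / measure \<mu> (ball 0 e) < a) (at_right 0)"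
      using pos
    proof eventually_elim
      case (elim e)
      then have "measure \<mu> (ball h e) / measure \<mu> (ball 0 e) \<le> exp (e * norm (preimage n h) - ?s / 2)"
        using measure_ball_upper[of h e n] measure_ball_pos[of e] by (simp add: divide_le_eq)
      with elim show ?case by linarith
    qed
  }
qed

end

subsection \<open>Equivalent shifts\<close>

text \<open>Equivalence of shifts depends on null sets only, and a positive density does not change
  these. Hence the posterior inherits the admissible shifts of the prior.\<close>

lemma equivalent_shifts_density:
  assumes [measurable_cong]: "sets \<mu> = sets borel" and [measurable]: "f \<in> borel_measurable borel"
    and pos: "\<And>x. f x > 0"
  shows "equivalent_shifts (density \<mu> f) = equivalent_shifts \<mu>"
proof -
  have null: "null_sets (density \<mu> f) = null_sets \<mu>"
  proof (rule set_eqI)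
    have "f x \<noteq> 0" for x using pos[of x] by simp
    then have "A \<in> null_sets (density \<mu> f) \<longleftrightarrow> A \<in> sets \<mu> \<and> (AE x in \<mu>. x \<notin> A)" for A
      by (subst null_sets_density_iff) simp_all
    then show "A \<in> null_sets (density \<mu> f) \<longleftrightarrow> A \<in> null_sets \<mu>" for A
      using AE_iff_null_sets[of A \<mu>] null_setsD2[of A \<mu>] by blast
  qed
  have "null_sets (distr (density \<mu> f) borel (\<lambda>x. x + h)) = null_sets (distr \<mu> borel (\<lambda>x. x + h))" for h
  proof -
    have "(\<lambda>x. x + h) \<in> measurable (density \<mu> f) borel" "(\<lambda>x. x + h) \<in> measurable \<mu> borel"
      by measurable
    then show ?thesis
      using null by (simp add: set_eq_iff null_sets_distr_iff)
  qed
  with null show ?thesis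
    by (simp add: equivalent_shifts_def absolutely_continuous_def)
qed

context diagonal_gaussian
begin

text \<open>
  The density \<open>f\<close> of the shift satisfies \<open>f \<le> K + f\<^sup>2 / K\<close>. The resulting bound depends on \<open>g\<close>
  only through \<open>C g \<bullet> g\<close>, hence is uniform in the truncations of a Cameron--Martin vector.
\<close>

lemma emeasure_shift_C_le:
  assumes [measurable]: "U \<in> sets borel" and K: "K > 0"
  shows "emeasure \<mu> {u. u + C g \<in> U} \<le> ennreal K * emeasure \<mu> U + ennreal (exp (C g \<bullet> g) / K)"
proof -
  let ?f = "\<lambda>g u. exp (u \<bullet> g - (C g \<bullet> g) / 2)" and ?g2 = "2 *\<^sub>R g"
  have "emeasure \<mu> {u. u + C g \<in> U} = (\<integral>\<^sup>+u. ennreal (?f g u) * indicator U u \<partial>\<mu>)"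
    by (rule cameron_martin_emeasure) fact
  also have "\<dots> \<le> (\<integral>\<^sup>+u. ennreal K * indicator U u + ennreal (exp (C g \<bullet> g) / K) * ennreal (?f ?g2 u) \<partial>\<mu>)"
  proof (intro nn_integral_mono)
    fix u
    \<comment> \<open>Up to a constant, the square of the density for \<open>g\<close> is the
      density for \<open>2 *\<^sub>R g\<close>, which has integral \<open>1\<close>.\<close>
    have sq: "exp (C g \<bullet> g) * ?f ?g2 u = (?f g u)\<^sup>2"
      by (simp add: C_scaleR power2_eq_square mult_exp_exp algebra_simps)
    have "?f g u \<le> K + (?f g u)\<^sup>2 / K"
    proof (cases "?f g u \<le> K")
      case True
      then show ?thesis using K by (simp add: add_increasing2)
    next
      case False
      then have "?f g u * K \<le> (?f g u)\<^sup>2"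
        by (simp add: power2_eq_square)
      then have "?f g u \<le> (?f g u)\<^sup>2 / K"
        using K by (simp only: pos_le_divide_eq)
      then show ?thesis using K by linarith
    qed
    then have "?f g u \<le> K + exp (C g \<bullet> g) / K * ?f ?g2 u"
      by (simp only: sq[symmetric] times_divide_eq_left)
    then have "ennreal (?f g u) \<le> ennreal (K + exp (C g \<bullet> g) / K * ?f ?g2 u)"
      by (rule ennreal_leI)
    also have "\<dots> = ennreal K + ennreal (exp (C g \<bullet> g) / K * ?f ?g2 u)"
      using K by (intro ennreal_plus) simp_all
    also have "\<dots> = ennreal K + ennreal (exp (C g \<bullet> g) / K) * ennreal (?f ?g2 u)"
      using K by (subst ennreal_mult) simp_all
    finally show "ennreal (?f g u) * indicator U u \<le>
        ennreal K * indicator U u + ennreal (exp (C g \<bullet> g) / K) * ennreal (?f ?g2 u)"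
      by (cases "u \<in> U") simp_all
  qed
  also have "\<dots> = ennreal K * emeasure \<mu> U + ennreal (exp (C g \<bullet> g) / K) * (\<integral>\<^sup>+u. ennreal (?f ?g2 u) \<partial>\<mu>)"
    by (subst nn_integral_add) (simp_all add: nn_integral_cmult nn_integral_cmult_indicator)
  finally show ?thesis
    by (simp only: exp_inner_nn_integral mult_1_right)
qed

text \<open>For open \<open>U\<close>, a point with \<open>u + h \<in> U\<close> has
  \<open>u + trunc n h \<in> U\<close> for all large \<open>n\<close>. The uniform bound for
  truncations therefore passes to the increasing union of the sets \<open>V N\<close>.\<close>

lemma measure_shift_open_le:
  assumes "open U" and K: "K > 0" and h: "summable (\<lambda>k. (h \<bullet> \<phi> k)\<^sup>2 / \<nu> k)"
  shows "measure \<mu> {u. u + h \<in> U} \<le> K * measure \<mu> U + exp (\<Sum>k. (h \<bullet> \<phi> k)\<^sup>2 / \<nu> k) / K"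
proof -
  let ?S = "\<Sum>k. (h \<bullet> \<phi> k)\<^sup>2 / \<nu> k"
  have [measurable]: "U \<in> sets borel" using assms by simp
  have trunc_le: "measure \<mu> {u. u + trunc n h \<in> U} \<le> K * measure \<mu> U + exp ?S / K" for n
  proof -
    have "ennreal (measure \<mu> {u. u + C (preimage n h) \<in> U}) \<le>
        ennreal (K * measure \<mu> U + exp (C (preimage n h) \<bullet> preimage n h) / K)"
      using emeasure_shift_C_le[of U K "preimage n h"] K
      unfolding emeasure_eq_measure by (subst ennreal_plus) (simp_all add: ennreal_mult)
    then have "measure \<mu> {u. u + C (preimage n h) \<in> U} \<le> K * measure \<mu> U + exp (C (preimage n h) \<bullet> preimage n h) / K"
      using K by (subst (asm) ennreal_le_iff) simp_all
    also have "\<dots> \<le> K * measure \<mu> U + exp ?S / K"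
      unfolding C_preimage_inner using h \<nu>_pos K
      by (auto intro!: divide_right_mono sum_le_suminf simp: less_imp_le)
    finally show ?thesis by (simp only: C_preimage)
  qed
  define V where "V N = {u. \<forall>n\<ge>N. u + trunc n h \<in> U}" for N
  have [measurable]: "V N \<in> sets \<mu>" for N
    unfolding V_def by measurable
  have "(\<lambda>N. measure \<mu> (V N)) \<longlonglongrightarrow> measure \<mu> (\<Union>N. V N)"
    by (rule finite_Lim_measure_incseq) (auto simp: incseq_def V_def)
  moreover have "measure \<mu> (V N) \<le> K * measure \<mu> U + exp ?S / K" for N
  proof -
    have "measure \<mu> (V N) \<le> measure \<mu> {u. u + trunc N h \<in> U}"
    proof (rule finite_measure_mono)
      show "{u. u + trunc N h \<in> U} \<in> sets \<mu>" by measurable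
    qed (auto simp: V_def)
    with trunc_le[of N] show ?thesis by linarith
  qed
  ultimately have "measure \<mu> (\<Union>N. V N) \<le> K * measure \<mu> U + exp ?S / K"
    by (auto intro: LIMSEQ_le_const2)
  moreover have "measure \<mu> {u. u + h \<in> U} \<le> measure \<mu> (\<Union>N. V N)"
  proof (rule finite_measure_mono)
    show "{u. u + h \<in> U} \<subseteq> (\<Union>N. V N)"
    proof
      fix u assume u: "u \<in> {u. u + h \<in> U}"
      have "(\<lambda>n. u + trunc n h) \<longlonglongrightarrow> u + h"
        by (intro tendsto_intros trunc_tendsto)
      then have "eventually (\<lambda>n. u + trunc n h \<in> U) sequentially"
        using \<open>open U\<close> u by (auto dest: topological_tendstoD)
      then show "u \<in> (\<Union>N. V N)"
        by (auto simp: eventually_sequentially V_def)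
    qed
    show "(\<Union>N. V N) \<in> sets \<mu>" by measurable
  qed
  ultimately show ?thesis by linarith
qed

lemma null_set_shift:
  assumes h: "summable (\<lambda>k. (h \<bullet> \<phi> k)\<^sup>2 / \<nu> k)" and A: "A \<in> null_sets \<mu>"
  shows "{u. u + h \<in> A} \<in> null_sets \<mu>"
proof -
  let ?S = "\<Sum>k. (h \<bullet> \<phi> k)\<^sup>2 / \<nu> k"
  have [measurable]: "A \<in> sets borel" using A by (auto dest: null_setsD2)
  have "measure \<mu> {u. u + h \<in> A} \<le> \<eta>" if "\<eta> > 0" for \<eta>
  proof -
    \<comment> \<open>\<open>K\<close> makes the second term of \<open>measure_shift_open_le\<close>
      equal to \<open>\<eta> / 2\<close>; outer regularity then provides an open \<open>U\<close> so
      small that the first term is at most \<open>\<eta> / 2\<close>.\<close>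
    define K where "K = 2 * exp ?S / \<eta>"
    have K: "K > 0" "exp ?S / K = \<eta> / 2"
      using that by (simp_all add: K_def)
    have "(INF U\<in>{U. A \<subseteq> U \<and> open U}. emeasure \<mu> U) = emeasure \<mu> A"
      by (rule outer_regular[symmetric]) (simp_all add: emeasure_eq_measure)
    then have "(INF U\<in>{U. A \<subseteq> U \<and> open U}. emeasure \<mu> U) < ennreal (\<eta> / (2 * K))"
      using that K(1) null_setsD1[OF A] by simp
    then obtain U where U: "A \<subseteq> U" "open U" "emeasure \<mu> U < ennreal (\<eta> / (2 * K))"
      unfolding INF_less_iff by blast
    have "measure \<mu> U < \<eta> / (2 * K)"
      using U(3) by (simp add: emeasure_eq_measure ennreal_less_iff)
    then have "K * measure \<mu> U \<le> \<eta> / 2"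
      using K(1) by (simp add: field_simps)
    moreover have "measure \<mu> {u. u + h \<in> U} \<le> K * measure \<mu> U + \<eta> / 2"
      using measure_shift_open_le[OF U(2) K(1) h] unfolding K(2) .
    moreover have "measure \<mu> {u. u + h \<in> A} \<le> measure \<mu> {u. u + h \<in> U}"
    proof (rule finite_measure_mono)
      have [measurable]: "U \<in> sets borel" using U by simp
      show "{u. u + h \<in> U} \<in> sets \<mu>" by measurable
    qed (use U in auto)
    ultimately show ?thesis by linarith
  qed
  then have "measure \<mu> {u. u + h \<in> A} \<le> 0"
    by (rule field_le_epsilon[of _ 0, simplified])
  moreover have "{u. u + h \<in> A} \<in> sets \<mu>" by measurable
  ultimately show ?thesis
    by (simp add: null_sets_def emeasure_eq_measure measure_le_0_iff)
qed

text \<open>A Chernoff bound: \<open>u \<bullet> g\<close> has variance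
  \<open>C g \<bullet> g\<close>, and for a threshold of half the variance the optimal parameter is
  \<open>1/2\<close>, whence the \<open>8\<close>.\<close>

lemma measure_half_space_le: "measure \<mu> {u. u \<bullet> g \<ge> (C g \<bullet> g) / 2} \<le> exp (- (C g \<bullet> g) / 8)"
proof -
  let ?q = "C g \<bullet> g" and ?g = "(1/2) *\<^sub>R g"
  let ?A = "{u. u \<bullet> g \<ge> ?q / 2}"
  have [measurable]: "?A \<in> sets borel" by measurable
  have "ennreal (exp (?q / 8)) * emeasure \<mu> ?A = (\<integral>\<^sup>+u. ennreal (exp (?q / 8)) * indicator ?A u \<partial>\<mu>)"
    by (rule nn_integral_cmult_indicator[symmetric]) simp
  also have "\<dots> \<le> (\<integral>\<^sup>+u. ennreal (exp (u \<bullet> ?g - (C ?g \<bullet> ?g) / 2)) \<partial>\<mu>)"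
    by (intro nn_integral_mono) (auto simp: C_scaleR split: split_indicator)
  finally have "ennreal (exp (?q / 8) * measure \<mu> ?A) \<le> 1"
    by (simp only: exp_inner_nn_integral emeasure_eq_measure ennreal_mult exp_ge_zero measure_nonneg)
  then have "exp (?q / 8) * measure \<mu> ?A \<le> 1"
    by (simp add: ennreal_le_1)
  then show ?thesis
    by (simp add: exp_minus field_simps)
qed

text \<open>
  If \<open>h\<close> is not a Cameron--Martin vector, the half spaces \<open>u \<bullet> g\<^sub>n \<ge> (C g\<^sub>n \<bullet> g\<^sub>n) / 2\<close>
  with \<open>C g\<^sub>n = trunc n h\<close> separate \<open>\<mu>\<close> from its shift in the limit.
\<close>

lemma not_absolutely_continuous_shift:
  assumes h: "\<not> summable (\<lambda>k. (h \<bullet> \<phi> k)\<^sup>2 / \<nu> k)"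
  shows "\<not> absolutely_continuous \<mu> (distr \<mu> borel (\<lambda>u. u + h))"
proof
  assume ac: "absolutely_continuous \<mu> (distr \<mu> borel (\<lambda>u. u + h))"
  let ?S = "\<lambda>n. \<Sum>k<n. (h \<bullet> \<phi> k)\<^sup>2 / \<nu> k"
  \<comment> \<open>The factor \<open>8\<close> turns the half-space bound into
    \<open>exp (- 1) ^ j\<close>, which is summable as Borel--Cantelli requires.\<close>
  have "\<exists>n. ?S n \<ge> 8 * real j" for j
  proof (rule ccontr)
    assume "\<nexists>n. ?S n \<ge> 8 * real j"
    then have "summable (\<lambda>k. (h \<bullet> \<phi> k)\<^sup>2 / \<nu> k)"
      using \<nu>_pos by (intro summableI_nonneg_bounded[of _ "8 * real j"]) (auto simp: less_imp_le not_le)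
    with h show False ..
  qed
  then obtain n where n: "\<And>j. ?S (n j) \<ge> 8 * real j" by metis
  define g where "g j = preimage (n j) h" for j
  have q: "C (g j) \<bullet> g j = ?S (n j)" "h \<bullet> g j = ?S (n j)" for j
    by (simp_all add: g_def C_preimage_inner inner_preimage)
  define A where "A j = {u. u \<bullet> g j \<ge> ?S (n j) / 2}" for j
  define B where "B j = {u. u + h \<notin> A j}" for j
  have [measurable]: "A j \<in> sets borel" "B j \<in> sets borel" for j
    unfolding A_def B_def by measurable
  have small: "exp (- ?S (n j) / 8) \<le> (exp (- 1)) ^ j" for j
    using n[of j] by (simp flip: exp_of_nat_mult)
  have "measure \<mu> (A j) \<le> (exp (- 1)) ^ j" for j
    using measure_half_space_le[of "g j"] small[of j] by (simp add: A_def q)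
  moreover have "measure \<mu> (B j) \<le> (exp (- 1)) ^ j" for j
  proof -
    \<comment> \<open>As \<open>h \<bullet> g j\<close> is twice the threshold of
      \<open>A j\<close>, a point of \<open>B j\<close> lies in the opposite half space, the one for
      \<open>- g j\<close>.\<close>
    have "measure \<mu> (B j) \<le> measure \<mu> {u. u \<bullet> (- g j) \<ge> (C (- g j) \<bullet> (- g j)) / 2}"
      by (intro finite_measure_mono) (auto simp: A_def B_def C_uminus q inner_add_left)
    also have "\<dots> \<le> exp (- ?S (n j) / 8)"
      using measure_half_space_le[of "- g j"] by (simp add: C_uminus q)
    finally show ?thesis using small[of j] by simp
  qed
  moreover have "summable f" if "\<And>j. \<bar>f j\<bar> \<le> (exp (- 1)) ^ j" for f :: "nat \<Rightarrow> real"
    by (rule summable_comparison_test'[of "\<lambda>j. exp (- 1) ^ j" 0])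
      (simp_all add: summable_geometric_iff that)
  ultimately have "summable (\<lambda>j. measure \<mu> (A j))" "summable (\<lambda>j. measure \<mu> (B j))"
    by simp_all
  then have null: "limsup A \<in> null_sets \<mu>" "limsup B \<in> null_sets \<mu>"
    by (auto intro!: borel_cantelli_limsup1 simp: emeasure_eq_measure)
  then have "limsup A \<in> null_sets (distr \<mu> borel (\<lambda>u. u + h))"
    using ac by (auto simp: absolutely_continuous_def)
  then have "{u. u + h \<in> limsup A} \<in> null_sets \<mu>"
    by (subst (asm) null_sets_distr_iff) (auto simp: vimage_def)
  then have null': "{u. u + h \<in> limsup A} \<union> limsup B \<in> null_sets \<mu>"
    using null by blast
  \<comment> \<open>Outside \<open>limsup B\<close> the point \<open>u + h\<close> is in
    \<open>A j\<close> for all large \<open>j\<close>, in particular infinitely often. So two null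
    sets would cover the space.\<close>
  have "u + h \<in> limsup A" if "u \<notin> limsup B" for u
  proof -
    have "\<exists>N. \<forall>j\<ge>N. u + h \<in> A j"
      using that by (auto simp: limsup_INF_SUP B_def)
    then obtain N where N: "\<And>j. j \<ge> N \<Longrightarrow> u + h \<in> A j" by blast
    have "\<exists>j\<ge>m. u + h \<in> A j" for m
      using N[of "max m N"] by (intro exI[of _ "max m N"]) simp
    then show ?thesis by (auto simp: limsup_INF_SUP)
  qed
  then have "{u. u + h \<in> limsup A} \<union> limsup B = UNIV" by auto
  with null' have "UNIV \<in> null_sets \<mu>" by simp
  then show False
    using emeasure_space_1 by (simp add: null_sets_def)
qed

text \<open>For sufficiency, \<open>null_set_shift\<close> is applied to \<open>h\<close> and to
  \<open>- h\<close>, one for each direction of absolute continuity.\<close>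

theorem equivalent_shifts_eq: "equivalent_shifts \<mu> = {h. summable (\<lambda>k. (h \<bullet> \<phi> k)\<^sup>2 / \<nu> k)}"
proof (intro equalityI subsetI CollectI)
  fix h assume "h \<in> equivalent_shifts \<mu>"
  then show "summable (\<lambda>k. (h \<bullet> \<phi> k)\<^sup>2 / \<nu> k)"
    using not_absolutely_continuous_shift by (auto simp: equivalent_shifts_def)
next
  fix h assume "h \<in> {h. summable (\<lambda>k. (h \<bullet> \<phi> k)\<^sup>2 / \<nu> k)}"
  then have h: "summable (\<lambda>k. (h \<bullet> \<phi> k)\<^sup>2 / \<nu> k)" "summable (\<lambda>k. (- h \<bullet> \<phi> k)\<^sup>2 / \<nu> k)"
    by simp_all
  have distr_iff: "A \<in> null_sets (distr \<mu> borel (\<lambda>u. u + h)) \<longleftrightarrow>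
      {u. u + h \<in> A} \<in> null_sets \<mu> \<and> A \<in> sets borel" for A
    by (subst null_sets_distr_iff) (auto simp: vimage_def)
  have "null_sets \<mu> \<subseteq> null_sets (distr \<mu> borel (\<lambda>u. u + h))"
  proof
    fix A assume A: "A \<in> null_sets \<mu>"
    then have "A \<in> sets borel" using null_setsD2[OF A] by simp
    with null_set_shift[OF h(1) A] show "A \<in> null_sets (distr \<mu> borel (\<lambda>u. u + h))"
      by (simp only: distr_iff)
  qed
  moreover have "null_sets (distr \<mu> borel (\<lambda>u. u + h)) \<subseteq> null_sets \<mu>"
  proof
    fix A assume "A \<in> null_sets (distr \<mu> borel (\<lambda>u. u + h))"
    then have "{u. u + h \<in> A} \<in> null_sets \<mu>" by (simp only: distr_iff)
    from null_set_shift[OF h(2) this] show "A \<in> null_sets \<mu>" by simp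
  qed
  ultimately show "h \<in> equivalent_shifts \<mu>"
    by (simp add: equivalent_shifts_def absolutely_continuous_def)
qed

end

subsection \<open>The posterior\<close>

text \<open>
  With \<open>\<eta> k = exp (\<alpha> k) * (y \<bullet> \<phi> k)\<close> and
  \<open>c k = sqrt 2 / b * (\<alpha> k powr (\<beta> / 2) * exp (- \<alpha> k))\<close> the function \<open>V\<close> below is \<open>\<Phi>\<close>.
\<close>

locale laplace_posterior = diagonal_gaussian +
  fixes c \<eta> :: "nat \<Rightarrow> real" and B :: real
  assumes c_nonneg: "\<And>k. c k \<ge> 0" and c_summable: "summable c"
    and \<nu>_le: "\<And>k. \<nu> k \<le> B"
begin

definition V :: "'a \<Rightarrow> real" where
  "V u = (\<Sum>k. c k * (\<bar>\<eta> k - u \<bullet> \<phi> k\<bar> - \<bar>\<eta> k\<bar>))"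

definition L :: real where
  "L = (\<Sum>k. c k)"

lemma L_nonneg: "L \<ge> 0"
  unfolding L_def by (intro suminf_nonneg c_summable c_nonneg)

lemma weighted_abs_summable: "summable (\<lambda>k. c k * \<bar>x \<bullet> \<phi> k\<bar>)"
proof (rule summable_comparison_test')
  show "summable (\<lambda>k. c k * norm x)"
    by (intro summable_mult2 c_summable)
  show "norm (c n * \<bar>x \<bullet> \<phi> n\<bar>) \<le> c n * norm x" for n
    using c_nonneg abs_coord_le_norm[of x n] by (simp add: mult_left_mono)
qed

lemma weighted_abs_le: "(\<Sum>k. c k * \<bar>x \<bullet> \<phi> k\<bar>) \<le> L * norm x"
proof -
  have "(\<Sum>k. c k * \<bar>x \<bullet> \<phi> k\<bar>) \<le> (\<Sum>k. c k * norm x)"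
    using c_nonneg abs_coord_le_norm
    by (intro suminf_le weighted_abs_summable summable_mult2 c_summable mult_left_mono)
  then show ?thesis
    by (simp add: L_def suminf_mult2[OF c_summable])
qed

lemma V_summable: "summable (\<lambda>k. c k * (\<bar>\<eta> k - u \<bullet> \<phi> k\<bar> - \<bar>\<eta> k\<bar>))"
proof (rule summable_comparison_test'[OF weighted_abs_summable[of u]])
  show "norm (c n * (\<bar>\<eta> n - u \<bullet> \<phi> n\<bar> - \<bar>\<eta> n\<bar>)) \<le> c n * \<bar>u \<bullet> \<phi> n\<bar>" for n
    using c_nonneg[of n] by (auto simp: abs_mult intro!: mult_left_mono)
qed

text \<open>Each summand is Lipschitz with constant \<open>c k\<close> in its coordinate, and these
  constants are summable. Thus \<open>V\<close> varies by at most \<open>L * e\<close> from its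
  central value on a ball of radius \<open>e\<close>.\<close>

lemma V_lipschitz: "\<bar>V u - V v\<bar> \<le> L * norm (u - v)"
proof -
  let ?d = "\<lambda>k. c k * (\<bar>\<eta> k - u \<bullet> \<phi> k\<bar> - \<bar>\<eta> k\<bar>) - c k * (\<bar>\<eta> k - v \<bullet> \<phi> k\<bar> - \<bar>\<eta> k\<bar>)"
  have le: "\<bar>?d k\<bar> \<le> c k * \<bar>(u - v) \<bullet> \<phi> k\<bar>" for k
  proof -
    have "?d k = c k * (\<bar>\<eta> k - u \<bullet> \<phi> k\<bar> - \<bar>\<eta> k - v \<bullet> \<phi> k\<bar>)"
      by (simp add: algebra_simps)
    moreover have "\<bar>\<bar>\<eta> k - u \<bullet> \<phi> k\<bar> - \<bar>\<eta> k - v \<bullet> \<phi> k\<bar>\<bar> \<le> \<bar>(u - v) \<bullet> \<phi> k\<bar>"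
      by (simp add: inner_diff_left)
    ultimately show ?thesis
      using c_nonneg[of k] by (simp add: abs_mult mult_left_mono)
  qed
  have "V u - V v = (\<Sum>k. ?d k)"
    unfolding V_def by (intro suminf_diff V_summable)
  moreover have "\<bar>\<Sum>k. ?d k\<bar> \<le> (\<Sum>k. \<bar>?d k\<bar>)"
    by (intro summable_rabs summable_comparison_test'[OF weighted_abs_summable[of "u - v"], of 0]) (use le in simp)
  moreover have "\<dots> \<le> (\<Sum>k. c k * \<bar>(u - v) \<bullet> \<phi> k\<bar>)"
    by (intro suminf_le le weighted_abs_summable
        summable_comparison_test'[OF weighted_abs_summable[of "u - v"], of 0]) (use le in simp)
  ultimately show ?thesis
    using weighted_abs_le[of "u - v"] by linarith
qed

lemma V_measurable [measurable]: "V \<in> borel_measurable borel"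
proof (rule borel_measurable_continuous_onI, rule lipschitz_on_continuous_on)
  show "L-lipschitz_on UNIV V"
    using V_lipschitz L_nonneg by (auto simp: lipschitz_on_def dist_norm)
qed

text \<open>The minimiser in \<open>t\<close> of
  \<open>c k * \<bar>\<eta> k - t\<bar> + t\<^sup>2 / (2 * \<nu> k)\<close>: the slope
  \<open>t / \<nu> k\<close> of the quadratic can be balanced by the first term only while it is at
  most \<open>c k\<close> in absolute value.\<close>

definition mode_coord :: "nat \<Rightarrow> real" where
  "mode_coord k = max (- (\<nu> k * c k)) (min (\<nu> k * c k) (\<eta> k))"

lemma mode_coord_bound: "\<bar>mode_coord k\<bar> \<le> \<nu> k * c k"
proof -
  have "0 \<le> \<nu> k * c k"
    using \<nu>_pos[of k] c_nonneg[of k] by simp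
  then show ?thesis
    unfolding mode_coord_def by linarith
qed

text \<open>Clamping bounds the quotient by \<open>c k\<close>, and \<open>c k \<le> L\<close>, so
  its square is at most \<open>L * c k\<close>.\<close>

lemma ex_mode_preimage: "\<exists>g. \<forall>k. g \<bullet> \<phi> k = mode_coord k / \<nu> k"
proof -
  have "summable (\<lambda>k. (mode_coord k / \<nu> k)\<^sup>2)"
  proof (rule summable_comparison_test'[OF summable_mult[OF c_summable]])
    fix k
    have "\<bar>mode_coord k / \<nu> k\<bar> \<le> c k"
      using mode_coord_bound[of k] \<nu>_pos[of k] by (simp add: divide_le_eq mult.commute)
    moreover have "c k \<le> L"
      using sum_le_suminf[OF c_summable, of "{k}"] c_nonneg by (simp add: L_def)
    ultimately have "\<bar>mode_coord k / \<nu> k\<bar> * \<bar>mode_coord k / \<nu> k\<bar> \<le> L * c k"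
      using c_nonneg[of k] L_nonneg by (intro mult_mono) auto
    then show "norm ((mode_coord k / \<nu> k)\<^sup>2) \<le> L * c k"
      by (simp add: power2_eq_square)
  qed
  then show ?thesis
    using riesz_fischer[of "\<lambda>k. mode_coord k / \<nu> k"] by blast
qed

definition mode_preimage :: 'a where
  "mode_preimage = (SOME g. \<forall>k. g \<bullet> \<phi> k = mode_coord k / \<nu> k)"

definition mode :: 'a where
  "mode = C mode_preimage"

lemma mode_preimage_coord: "mode_preimage \<bullet> \<phi> k = mode_coord k / \<nu> k"
  unfolding mode_preimage_def using someI_ex[OF ex_mode_preimage] by blast

lemma mode_coord_eq: "mode \<bullet> \<phi> k = mode_coord k"
  using \<nu>_pos[of k] by (simp add: mode_def C_coord mode_preimage_coord)

lemma mode_summable: "summable (\<lambda>k. (mode \<bullet> \<phi> k)\<^sup>2 / \<nu> k)"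
proof -
  have "\<nu> k * (mode_preimage \<bullet> \<phi> k) * (mode_preimage \<bullet> \<phi> k) = (mode \<bullet> \<phi> k)\<^sup>2 / \<nu> k" for k
    using \<nu>_pos[of k] by (simp add: mode_coord_eq mode_preimage_coord power2_eq_square)
  then show ?thesis
    using sums_summable[OF C_inner_sums[of mode_preimage mode_preimage]] by simp
qed

text \<open>
  The change of \<open>V\<close> along \<open>x\<close> at the mode, with the linear term compensated by that of the
  quadratic part; the projection is chosen such that each summand is minimal at \<open>x = 0\<close>.
\<close>

definition excess_term :: "nat \<Rightarrow> real \<Rightarrow> real" where
  "excess_term k t =
    c k * (\<bar>\<eta> k - mode_coord k - t\<bar> - \<bar>\<eta> k - mode_coord k\<bar>) + mode_coord k / \<nu> k * t"

definition excess :: "'a \<Rightarrow> real" where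
  "excess x = (\<Sum>k. excess_term k (x \<bullet> \<phi> k))"

text \<open>The claim says that \<open>- mode_coord k / \<nu> k\<close> is a subgradient at
  \<open>t = 0\<close> of the absolute value term. Without clamping that term has its kink there and
  any slope up to \<open>c k\<close> is allowed; with clamping the slope is exactly
  \<open>c k\<close> or \<open>- c k\<close>.\<close>

lemma excess_term_nonneg: "excess_term k t \<ge> 0"
proof -
  let ?m = "mode_coord k"
  have pos: "\<nu> k * c k \<ge> 0" using \<nu>_pos[of k] c_nonneg[of k] by simp
  consider "?m = \<eta> k" | "\<eta> k > \<nu> k * c k" "?m = \<nu> k * c k" | "\<eta> k < - (\<nu> k * c k)" "?m = - (\<nu> k * c k)"
    using pos by (fastforce simp: mode_coord_def max_def min_def split: if_splits)
  then show ?thesis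
  proof cases
    case 1
    have "\<bar>?m / \<nu> k\<bar> \<le> c k"
      using mode_coord_bound[of k] \<nu>_pos[of k] by (simp add: divide_le_eq mult.commute)
    then have "\<bar>?m / \<nu> k * t\<bar> \<le> c k * \<bar>t\<bar>"
      unfolding abs_mult by (intro mult_right_mono) auto
    moreover have "excess_term k t = c k * \<bar>t\<bar> + ?m / \<nu> k * t"
      using 1 by (simp add: excess_term_def)
    ultimately show ?thesis by linarith
  next
    case 2
    then have "excess_term k t = c k * (\<bar>\<eta> k - ?m - t\<bar> - (\<eta> k - ?m - t))"
      using \<nu>_pos[of k] by (simp add: excess_term_def algebra_simps)
    then show ?thesis using c_nonneg[of k] by simp
  next
    case 3
    then have "excess_term k t = c k * (\<bar>\<eta> k - ?m - t\<bar> + (\<eta> k - ?m - t))"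
      using \<nu>_pos[of k] by (simp add: excess_term_def algebra_simps)
    then show ?thesis using c_nonneg[of k] by simp
  qed
qed

lemma excess_term_le: "excess_term k t \<le> 2 * (c k * \<bar>t\<bar>)"
proof -
  have "\<bar>mode_coord k / \<nu> k\<bar> \<le> c k"
    using mode_coord_bound[of k] \<nu>_pos[of k] by (simp add: divide_le_eq mult.commute)
  then have "\<bar>mode_coord k / \<nu> k * t\<bar> \<le> c k * \<bar>t\<bar>"
    unfolding abs_mult by (intro mult_right_mono) auto
  moreover have "c k * (\<bar>\<eta> k - mode_coord k - t\<bar> - \<bar>\<eta> k - mode_coord k\<bar>) \<le> c k * \<bar>t\<bar>"
    using c_nonneg[of k] by (intro mult_left_mono) auto
  ultimately show ?thesis unfolding excess_term_def by linarith
qed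

lemma excess_summable: "summable (\<lambda>k. excess_term k (x \<bullet> \<phi> k))"
proof (rule summable_comparison_test'[OF summable_mult[OF weighted_abs_summable[of x]]])
  show "norm (excess_term k (x \<bullet> \<phi> k)) \<le> 2 * (c k * \<bar>x \<bullet> \<phi> k\<bar>)" for k
    using excess_term_le[of k "x \<bullet> \<phi> k"] excess_term_nonneg[of k "x \<bullet> \<phi> k"] by simp
qed

lemma excess_nonneg: "excess x \<ge> 0"
  unfolding excess_def by (intro suminf_nonneg excess_summable excess_term_nonneg)

lemma excess_le: "excess x \<le> 2 * L * norm x"
proof -
  have "excess x \<le> (\<Sum>k. 2 * (c k * \<bar>x \<bullet> \<phi> k\<bar>))"
    unfolding excess_def
    by (intro suminf_le excess_summable excess_term_le summable_mult weighted_abs_summable)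
  also have "\<dots> = 2 * (\<Sum>k. c k * \<bar>x \<bullet> \<phi> k\<bar>)"
    by (intro suminf_mult weighted_abs_summable)
  finally show ?thesis using weighted_abs_le[of x] by simp
qed

lemma V_mode_add: "V (mode + x) = V mode + excess x - x \<bullet> mode_preimage"
proof -
  let ?v = "\<lambda>u k. c k * (\<bar>\<eta> k - u \<bullet> \<phi> k\<bar> - \<bar>\<eta> k\<bar>)"
  have "?v (mode + x) k = ?v mode k + excess_term k (x \<bullet> \<phi> k) - (x \<bullet> \<phi> k) * (mode_preimage \<bullet> \<phi> k)" for k
    by (simp add: excess_term_def inner_add_left mode_coord_eq mode_preimage_coord algebra_simps)
  moreover have "(\<lambda>k. ?v mode k + excess_term k (x \<bullet> \<phi> k) - (x \<bullet> \<phi> k) * (mode_preimage \<bullet> \<phi> k)) sums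
      (V mode + excess x - x \<bullet> mode_preimage)"
    unfolding V_def excess_def
    by (intro sums_diff sums_add summable_sums V_summable excess_summable inner_sums)
  ultimately have "?v (mode + x) sums (V mode + excess x - x \<bullet> mode_preimage)"
    by simp
  then show ?thesis
    unfolding V_def by (simp add: sums_iff)
qed

lemma excess_measurable [measurable]: "excess \<in> borel_measurable borel"
proof -
  have "excess = (\<lambda>x. V (mode + x) - V mode + x \<bullet> mode_preimage)"
    by (simp add: V_mode_add)
  then show ?thesis by simp
qed

section \<open>The minimiser of the functional\<close>

definition J :: "'a \<Rightarrow> real" where
  "J u = V u + 1 / 2 * (\<Sum>k. (u \<bullet> \<phi> k)\<^sup>2 / \<nu> k)"

text \<open>The cross term of the quadratic part is \<open>x \<bullet> mode_preimage\<close> and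
  cancels the linear term of \<open>V_mode_add\<close>, so no derivative of \<open>V\<close> is
  needed.\<close>

lemma J_mode_add:
  assumes "summable (\<lambda>k. (x \<bullet> \<phi> k)\<^sup>2 / \<nu> k)"
  shows "J (mode + x) = J mode + excess x + 1 / 2 * (\<Sum>k. (x \<bullet> \<phi> k)\<^sup>2 / \<nu> k)"
    and "summable (\<lambda>k. ((mode + x) \<bullet> \<phi> k)\<^sup>2 / \<nu> k)"
proof -
  let ?q = "\<lambda>u k. (u \<bullet> \<phi> k)\<^sup>2 / \<nu> k"
  have "?q (mode + x) k = ?q mode k + 2 * ((x \<bullet> \<phi> k) * (mode_preimage \<bullet> \<phi> k)) + ?q x k" for k
    by (simp add: mode_preimage_coord mode_coord_eq inner_add_left power2_sum add_divide_distrib)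
  moreover have "(\<lambda>k. ?q mode k + 2 * ((x \<bullet> \<phi> k) * (mode_preimage \<bullet> \<phi> k)) + ?q x k) sums
      ((\<Sum>k. ?q mode k) + 2 * (x \<bullet> mode_preimage) + (\<Sum>k. ?q x k))"
    by (intro sums_add sums_mult summable_sums mode_summable inner_sums assms)
  ultimately have *: "?q (mode + x) sums ((\<Sum>k. ?q mode k) + 2 * (x \<bullet> mode_preimage) + (\<Sum>k. ?q x k))"
    by simp
  then show "summable (?q (mode + x))" by (rule sums_summable)
  show "J (mode + x) = J mode + excess x + 1 / 2 * (\<Sum>k. ?q x k)"
    unfolding J_def V_mode_add sums_unique[OF *, symmetric] by (simp add: algebra_simps)
qed

lemma suminf_coord_pos:
  assumes "summable (\<lambda>k. (x \<bullet> \<phi> k)\<^sup>2 / \<nu> k)" "x \<noteq> 0"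
  shows "(\<Sum>k. (x \<bullet> \<phi> k)\<^sup>2 / \<nu> k) > 0"
proof -
  obtain k where "x \<bullet> \<phi> k \<noteq> 0"
    using coord_eqI[of x 0] assms(2) by auto
  then show ?thesis
    using \<nu>_pos by (intro suminf_pos2[OF assms(1), of k]) (auto simp: less_imp_le)
qed

text \<open>Away from \<open>mode\<close> the quadratic remainder in \<open>J_mode_add\<close> is
  strictly positive and the excess is nonnegative, which gives minimality and uniqueness
  together.\<close>

lemma arg_min_J:
  "{u. is_arg_min J (\<lambda>u. summable (\<lambda>k. (u \<bullet> \<phi> k)\<^sup>2 / \<nu> k)) u} = {mode}"
proof -
  have less: "J mode < J u" if "summable (\<lambda>k. (u \<bullet> \<phi> k)\<^sup>2 / \<nu> k)" "u \<noteq> mode" for u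
  proof -
    have "summable (\<lambda>k. ((u - mode) \<bullet> \<phi> k)\<^sup>2 / \<nu> k)"
    proof (rule summable_comparison_test'[OF summable_add[OF summable_mult[OF that(1), of 2] summable_mult[OF mode_summable, of 2]]])
      fix k
      have "(u \<bullet> \<phi> k - mode \<bullet> \<phi> k)\<^sup>2 \<le> 2 * (u \<bullet> \<phi> k)\<^sup>2 + 2 * (mode \<bullet> \<phi> k)\<^sup>2"
        using sum_squares_bound[of "u \<bullet> \<phi> k" "- (mode \<bullet> \<phi> k)"] by (simp add: power2_diff)
      then show "norm (((u - mode) \<bullet> \<phi> k)\<^sup>2 / \<nu> k) \<le> 2 * ((u \<bullet> \<phi> k)\<^sup>2 / \<nu> k) + 2 * ((mode \<bullet> \<phi> k)\<^sup>2 / \<nu> k)"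
        using \<nu>_pos[of k] by (simp add: inner_diff_left divide_right_mono flip: add_divide_distrib)
    qed
    then show ?thesis
      using J_mode_add(1)[of "u - mode"] suminf_coord_pos[of "u - mode"] excess_nonneg[of "u - mode"] that(2)
      by simp
  qed
  then show ?thesis
    using mode_summable by (auto simp: is_arg_min_def) (metis less_asym)+
qed

text \<open>This is \<open>exp (- J mode)\<close>, with the quadratic part written through
  \<open>mode_preimage\<close>.\<close>

definition K :: real where
  "K = exp (- V mode - (C mode_preimage \<bullet> mode_preimage) / 2)"

text \<open>The exponential of the linear functional \<open>u \<bullet> mode_preimage\<close> from
  the Cameron--Martin density cancels against the linear term of \<open>V_mode_add\<close>.\<close>

lemma nn_integral_exp_V:
  assumes [measurable]: "F \<in> borel_measurable borel"
  shows "(\<integral>\<^sup>+u. ennreal (exp (- V u)) * F u \<partial>\<mu>) =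
    ennreal K * (\<integral>\<^sup>+u. ennreal (exp (- excess u)) * F (mode + u) \<partial>\<mu>)"
proof -
  let ?g = mode_preimage
  let ?q = "C ?g \<bullet> ?g"
  let ?G = "\<lambda>u. ennreal (exp (- (u \<bullet> ?g) + ?q / 2 - V u)) * F u"
  have "(\<integral>\<^sup>+u. ennreal (exp (- V u)) * F u \<partial>\<mu>) = (\<integral>\<^sup>+u. ennreal (exp (u \<bullet> ?g - ?q / 2)) * ?G u \<partial>\<mu>)"
    by (simp add: mult.assoc[symmetric] ennreal_mult[symmetric] mult_exp_exp)
  also have "\<dots> = (\<integral>\<^sup>+u. ?G (u + C ?g) \<partial>\<mu>)"
    by (rule cameron_martin[symmetric]) measurable
  also have "\<dots> = (\<integral>\<^sup>+u. ennreal K * (ennreal (exp (- excess u)) * F (mode + u)) \<partial>\<mu>)"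
  proof (intro nn_integral_cong)
    fix u
    have "- ((mode + u) \<bullet> ?g) + ?q / 2 - V (mode + u) = (- V mode - ?q / 2) + - excess u"
      unfolding V_mode_add by (simp add: mode_def inner_add_left)
    then have "exp (- ((mode + u) \<bullet> ?g) + ?q / 2 - V (mode + u)) = K * exp (- excess u)"
      by (simp only: K_def exp_add)
    then show "?G (u + C ?g) = ennreal K * (ennreal (exp (- excess u)) * F (mode + u))"
      by (simp add: mode_def[symmetric] add.commute ennreal_mult mult.assoc K_def)
  qed
  also have "\<dots> = ennreal K * (\<integral>\<^sup>+u. ennreal (exp (- excess u)) * F (mode + u) \<partial>\<mu>)"
    by (rule nn_integral_cmult) measurable
  finally show ?thesis .
qed

definition Z :: real where
  "Z = (LINT u|\<mu>. exp (- V u))"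

text \<open>\<open>V\<close> may be unbounded below, but after the shift to the mode the integrand
  is at most \<open>K\<close>, so no exponential moments of the norm are needed.\<close>

lemma nn_integral_Z: "(\<integral>\<^sup>+u. ennreal (exp (- V u)) \<partial>\<mu>) = ennreal Z"
proof -
  have "(\<integral>\<^sup>+u. ennreal (exp (- V u)) \<partial>\<mu>) = ennreal K * (\<integral>\<^sup>+u. ennreal (exp (- excess u)) \<partial>\<mu>)"
    using nn_integral_exp_V[of "\<lambda>_. 1"] by simp
  also have "\<dots> \<le> ennreal K * (\<integral>\<^sup>+u. 1 \<partial>\<mu>)"
    using excess_nonneg by (intro mult_left_mono nn_integral_mono) auto
  also have "\<dots> < \<infinity>"
    using emeasure_space_1 by simp
  finally have "integrable \<mu> (\<lambda>u. exp (- V u))"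
    by (intro integrableI_nonneg) auto
  then show ?thesis
    unfolding Z_def by (intro nn_integral_eq_integral) auto
qed

lemma Z_pos: "Z > 0"
proof -
  have "(\<integral>\<^sup>+u. ennreal (exp (- V u)) \<partial>\<mu>) \<noteq> 0"
  proof
    assume "(\<integral>\<^sup>+u. ennreal (exp (- V u)) \<partial>\<mu>) = 0"
    then have "AE u in \<mu>. False"
      by (subst (asm) nn_integral_0_iff_AE) auto
    then show False by simp
  qed
  then show ?thesis
    unfolding nn_integral_Z by (metis ennreal_eq_0_iff not_le)
qed

definition post :: "'a measure" where
  "post = density \<mu> (\<lambda>u. ennreal (1 / Z * exp (- V u)))"

lemma sets_post [simp]: "sets post = sets borel"
  by (simp add: post_def)

lemma emeasure_post:
  assumes [measurable]: "A \<in> sets borel"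
  shows "emeasure post A = ennreal (1 / Z) * (\<integral>\<^sup>+u. ennreal (exp (- V u)) * indicator A u \<partial>\<mu>)"
proof -
  have "emeasure post A = (\<integral>\<^sup>+u. ennreal (1 / Z * exp (- V u)) * indicator A u \<partial>\<mu>)"
    unfolding post_def by (rule emeasure_density) measurable
  also have "\<dots> = (\<integral>\<^sup>+u. ennreal (1 / Z) * (ennreal (exp (- V u)) * indicator A u) \<partial>\<mu>)"
    using Z_pos by (subst ennreal_mult) (simp_all add: mult.assoc)
  also have "\<dots> = ennreal (1 / Z) * (\<integral>\<^sup>+u. ennreal (exp (- V u)) * indicator A u \<partial>\<mu>)"
    by (rule nn_integral_cmult) measurable
  finally show ?thesis .
qed

lemma prob_space_post: "prob_space post"
proof (rule prob_spaceI)
  have "emeasure post UNIV = ennreal (1 / Z) * ennreal Z"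
    by (simp add: emeasure_post nn_integral_Z)
  also have "\<dots> = 1"
    using Z_pos by (simp flip: ennreal_mult)
  finally show "emeasure post (space post) = 1"
    by (simp add: post_def)
qed

interpretation post: prob_space post
  by (rule prob_space_post)

lemma measure_post_ball_le:
  assumes "\<And>u. u \<in> ball h e \<Longrightarrow> - V u \<le> a"
  shows "measure post (ball h e) \<le> exp a / Z * measure \<mu> (ball h e)"
proof -
  have "ennreal (measure post (ball h e)) = ennreal (1 / Z) * (\<integral>\<^sup>+u. ennreal (exp (- V u)) * indicator (ball h e) u \<partial>\<mu>)"
    by (simp add: emeasure_post flip: post.emeasure_eq_measure)
  also have "\<dots> \<le> ennreal (1 / Z) * (\<integral>\<^sup>+u. ennreal (exp a) * indicator (ball h e) u \<partial>\<mu>)"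
    using assms by (intro mult_left_mono nn_integral_mono) (auto split: split_indicator)
  also have "\<dots> = ennreal (1 / Z) * (ennreal (exp a) * emeasure \<mu> (ball h e))"
    by (subst nn_integral_cmult_indicator) simp_all
  also have "\<dots> = ennreal (exp a / Z * measure \<mu> (ball h e))"
    using Z_pos by (simp add: emeasure_eq_measure flip: ennreal_mult)
  finally show ?thesis
    using Z_pos by (subst (asm) ennreal_le_iff) simp_all
qed

lemma measure_post_ball_ge:
  assumes "\<And>u. u \<in> ball h e \<Longrightarrow> a \<le> - V u"
  shows "exp a / Z * measure \<mu> (ball h e) \<le> measure post (ball h e)"
proof -
  have "ennreal (exp a / Z * measure \<mu> (ball h e)) = ennreal (1 / Z) * (ennreal (exp a) * emeasure \<mu> (ball h e))"
    using Z_pos by (simp add: emeasure_eq_measure flip: ennreal_mult)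
  also have "\<dots> = ennreal (1 / Z) * (\<integral>\<^sup>+u. ennreal (exp a) * indicator (ball h e) u \<partial>\<mu>)"
    by (subst nn_integral_cmult_indicator) simp_all
  also have "\<dots> \<le> ennreal (1 / Z) * (\<integral>\<^sup>+u. ennreal (exp (- V u)) * indicator (ball h e) u \<partial>\<mu>)"
    using assms by (intro mult_left_mono nn_integral_mono) (auto split: split_indicator)
  also have "\<dots> = ennreal (measure post (ball h e))"
    by (simp add: emeasure_post flip: post.emeasure_eq_measure)
  finally show ?thesis
    by (subst (asm) ennreal_le_iff) simp_all
qed

text \<open>Normalising by the prior ball at \<open>0\<close> gives each centre a limit of its own,
  and the Onsager--Machlup quotient becomes a quotient of two limits.\<close>

lemma post_ball_ratio_tendsto:
  assumes h: "summable (\<lambda>k. (h \<bullet> \<phi> k)\<^sup>2 / \<nu> k)"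
  shows "((\<lambda>e. measure post (ball h e) / measure \<mu> (ball 0 e)) \<longlongrightarrow> exp (- J h) / Z) (at_right 0)"
proof (rule tendsto_sandwich)
  let ?S = "\<Sum>k. (h \<bullet> \<phi> k)\<^sup>2 / \<nu> k"
  let ?r = "\<lambda>e. measure \<mu> (ball h e) / measure \<mu> (ball 0 e)"
  have pos: "eventually (\<lambda>e::real. e > 0) (at_right 0)"
    by (simp add: eventually_at_right_less)
  have V_ball: "\<bar>V u - V h\<bar> \<le> L * e" if "u \<in> ball h e" for u e
  proof -
    have "L * norm (u - h) \<le> L * e"
      using that L_nonneg by (intro mult_left_mono) (auto simp: dist_norm norm_minus_commute)
    then show ?thesis using V_lipschitz[of u h] by linarith
  qed
  show "eventually (\<lambda>e. exp (- V h - L * e) / Z * ?r e \<le> measure post (ball h e) / measure \<mu> (ball 0 e)) (at_right 0)"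
    using pos
  proof eventually_elim
    case (elim e)
    have "exp (- V h - L * e) / Z * measure \<mu> (ball h e) \<le> measure post (ball h e)"
      by (rule measure_post_ball_ge) (use V_ball[of _ e] in fastforce)
    then have "exp (- V h - L * e) / Z * measure \<mu> (ball h e) / measure \<mu> (ball 0 e) \<le>
        measure post (ball h e) / measure \<mu> (ball 0 e)"
      by (intro divide_right_mono) simp_all
    then show ?case by simp
  qed
  show "eventually (\<lambda>e. measure post (ball h e) / measure \<mu> (ball 0 e) \<le> exp (- V h + L * e) / Z * ?r e) (at_right 0)"
    using pos
  proof eventually_elim
    case (elim e)
    have "measure post (ball h e) \<le> exp (- V h + L * e) / Z * measure \<mu> (ball h e)"
      by (rule measure_post_ball_le) (use V_ball[of _ e] in fastforce)
    then have "measure post (ball h e) / measure \<mu> (ball 0 e) \<le>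
        exp (- V h + L * e) / Z * measure \<mu> (ball h e) / measure \<mu> (ball 0 e)"
      by (intro divide_right_mono) simp_all
    then show ?case by simp
  qed
  have eq: "exp (- J h) / Z = exp (- V h - L * 0) / Z * exp (- ?S / 2)"
    "exp (- J h) / Z = exp (- V h + L * 0) / Z * exp (- ?S / 2)"
    by (simp_all add: J_def mult_exp_exp)
  show "((\<lambda>e. exp (- V h - L * e) / Z * ?r e) \<longlongrightarrow> exp (- J h) / Z) (at_right 0)"
    unfolding eq(1) by (intro tendsto_intros ball_ratio_tendsto h) (use Z_pos in simp)
  show "((\<lambda>e. exp (- V h + L * e) / Z * ?r e) \<longlongrightarrow> exp (- J h) / Z) (at_right 0)"
    unfolding eq(2) by (intro tendsto_intros ball_ratio_tendsto h) (use Z_pos in simp)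
qed

theorem onsager_machlup_post:
  "onsager_machlup post {h. summable (\<lambda>k. (h \<bullet> \<phi> k)\<^sup>2 / \<nu> k)} J"
  unfolding onsager_machlup_def
proof (intro conjI ballI)
  have "equivalent_shifts post = equivalent_shifts \<mu>"
    unfolding post_def using Z_pos by (intro equivalent_shifts_density) simp_all
  then show "{h. summable (\<lambda>k. (h \<bullet> \<phi> k)\<^sup>2 / \<nu> k)} = equivalent_shifts post"
    by (simp add: equivalent_shifts_eq)
  fix h1 h2
  assume "h1 \<in> {h. summable (\<lambda>k. (h \<bullet> \<phi> k)\<^sup>2 / \<nu> k)}" "h2 \<in> {h. summable (\<lambda>k. (h \<bullet> \<phi> k)\<^sup>2 / \<nu> k)}"
  then have "((\<lambda>e. (measure post (ball h1 e) / measure \<mu> (ball 0 e)) / (measure post (ball h2 e) / measure \<mu> (ball 0 e)))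
      \<longlongrightarrow> (exp (- J h1) / Z) / (exp (- J h2) / Z)) (at_right 0)"
    using Z_pos by (intro tendsto_divide post_ball_ratio_tendsto) simp_all
  also have "(exp (- J h1) / Z) / (exp (- J h2) / Z) = exp (J h2 - J h1)"
    using Z_pos by (simp add: exp_diff exp_minus field_simps)
  finally show "((\<lambda>e. measure post (ball h1 e) / measure post (ball h2 e)) \<longlongrightarrow> exp (J h2 - J h1)) (at_right 0)"
  proof (rule Lim_transform_eventually)
    show "eventually (\<lambda>e. (measure post (ball h1 e) / measure \<mu> (ball 0 e)) / (measure post (ball h2 e) / measure \<mu> (ball 0 e)) =
        measure post (ball h1 e) / measure post (ball h2 e)) (at_right 0)"
      using eventually_at_right_less[of "0::real"]
    proof eventually_elim
      case (elim e)
      then show ?case using measure_ball_pos[of e] by simp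
    qed
  qed
qed

section \<open>Posterior balls relative to the mode\<close>

lemma emeasure_post_ball_mode:
  "emeasure post (ball (mode + x) e) =
    ennreal (K / Z) * (\<integral>\<^sup>+u. ennreal (exp (- excess u)) * indicator (ball x e) u \<partial>\<mu>)"
proof -
  have "indicator (ball (mode + x) e) (mode + u) = (indicator (ball x e) u :: ennreal)" for u
    by (simp add: indicator_def dist_norm)
  then have eq: "emeasure post (ball (mode + x) e) =
      ennreal (1 / Z) * (ennreal K * (\<integral>\<^sup>+u. ennreal (exp (- excess u)) * indicator (ball x e) u \<partial>\<mu>))"
    by (subst emeasure_post, simp, subst nn_integral_exp_V) (simp_all add: borel_measurable_indicator)
  have "ennreal (K / Z) = ennreal (1 / Z) * ennreal K"
    using Z_pos by (simp add: K_def flip: ennreal_mult)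
  with eq show ?thesis by (simp only: mult.assoc)
qed

lemma measure_post_ball_mode_upper:
  "measure post (ball (mode + x) e) \<le> K / Z * measure \<mu> (ball x e)"
proof -
  have KZ: "K / Z \<ge> 0" using Z_pos by (simp add: K_def)
  have "ennreal (measure post (ball (mode + x) e)) \<le>
      ennreal (K / Z) * (\<integral>\<^sup>+u. indicator (ball x e) u \<partial>\<mu>)"
    unfolding post.emeasure_eq_measure[symmetric] emeasure_post_ball_mode using excess_nonneg
    by (intro mult_left_mono nn_integral_mono) (auto split: split_indicator)
  also have "\<dots> = ennreal (K / Z) * ennreal (measure \<mu> (ball x e))"
    by (simp add: emeasure_eq_measure)
  also have "\<dots> = ennreal (K / Z * measure \<mu> (ball x e))"
    using KZ by (intro ennreal_mult[symmetric]) simp_all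
  finally show ?thesis
    using ennreal_le_iff[OF mult_nonneg_nonneg[OF KZ measure_nonneg]] by blast
qed

lemma measure_post_ball_mode_lower:
  "K / Z * exp (- 2 * L * e) * measure \<mu> (ball 0 e) \<le> measure post (ball mode e)"
proof -
  have KZ: "K / Z \<ge> 0" using Z_pos by (simp add: K_def)
  have "ennreal (K / Z * exp (- 2 * L * e) * measure \<mu> (ball 0 e)) =
      ennreal (K / Z) * (ennreal (exp (- 2 * L * e)) * emeasure \<mu> (ball 0 e))"
    using KZ by (simp only: emeasure_eq_measure ennreal_mult mult.assoc exp_ge_zero measure_nonneg mult_nonneg_nonneg)
  also have "\<dots> = ennreal (K / Z) * (\<integral>\<^sup>+u. ennreal (exp (- 2 * L * e)) * indicator (ball 0 e) u \<partial>\<mu>)"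
    by (subst nn_integral_cmult_indicator) simp_all
  also have "\<dots> \<le> ennreal (K / Z) * (\<integral>\<^sup>+u. ennreal (exp (- excess u)) * indicator (ball 0 e) u \<partial>\<mu>)"
  proof (intro mult_left_mono nn_integral_mono)
    fix u
    have "excess u \<le> 2 * L * e" if "norm u < e"
    proof -
      have "2 * L * norm u \<le> 2 * L * e"
        using that L_nonneg by (intro mult_left_mono) auto
      then show ?thesis using excess_le[of u] by linarith
    qed
    then show "ennreal (exp (- 2 * L * e)) * indicator (ball 0 e) u \<le> ennreal (exp (- excess u)) * indicator (ball 0 e) u"
      by (auto split: split_indicator)
  qed simp
  also have "\<dots> = ennreal (measure post (ball mode e))"
    using emeasure_post_ball_mode[of 0 e] by (simp add: post.emeasure_eq_measure)
  finally show ?thesis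
    by (subst (asm) ennreal_le_iff) simp_all
qed

lemma measure_post_ball_mode_pos:
  assumes "e > 0"
  shows "measure post (ball mode e) > 0"
proof -
  have "0 < K / Z * exp (- 2 * L * e) * measure \<mu> (ball 0 e)"
    using Z_pos measure_ball_pos[OF assms] by (simp add: K_def)
  then show ?thesis
    using measure_post_ball_mode_lower[of e] by linarith
qed

text \<open>The displacement \<open>x\<close> is arbitrary, so this reduces both existence and
  uniqueness of the mode to ball ratios of the prior, over all centres of the space.\<close>

lemma measure_post_ball_ratio:
  assumes "e > 0"
  shows "measure post (ball (mode + x) e) / measure post (ball mode e) \<le>
    exp (2 * L * e) * (measure \<mu> (ball x e) / measure \<mu> (ball 0 e))"
proof -
  note pos = measure_ball_pos[OF assms]
  have "measure post (ball (mode + x) e) \<le>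
      K / Z * exp (- 2 * L * e) * measure \<mu> (ball 0 e) * (exp (2 * L * e) * (measure \<mu> (ball x e) / measure \<mu> (ball 0 e)))"
    using measure_post_ball_mode_upper[of x e] pos by (simp add: exp_minus field_simps)
  also have "\<dots> \<le> measure post (ball mode e) * (exp (2 * L * e) * (measure \<mu> (ball x e) / measure \<mu> (ball 0 e)))"
    by (intro mult_right_mono measure_post_ball_mode_lower) simp
  finally show ?thesis
    using measure_post_ball_mode_pos[OF assms] by (simp add: divide_le_eq mult.commute)
qed

lemma bdd_above_post: "bdd_above (range (\<lambda>x. measure post (ball x e)))"
  by (rule bdd_aboveI2[of _ _ 1]) simp

lemma strong_mode_mode: "strong_mode post mode"
  unfolding strong_mode_def
proof (rule tendsto_sandwich)
  let ?s = "\<lambda>e. SUP x. measure post (ball x e)"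
  show "eventually (\<lambda>e. exp (- (2 * L * e)) \<le> measure post (ball mode e) / ?s e) (at_right 0)"
    using eventually_at_right_less[of "0::real"]
  proof eventually_elim
    case (elim e)
    then have e: "e > 0" .
    have "?s e \<le> exp (2 * L * e) * measure post (ball mode e)"
    proof (rule cSUP_least)
      fix x :: 'a
      have "exp (2 * L * e) * (measure \<mu> (ball (x - mode) e) / measure \<mu> (ball 0 e)) \<le> exp (2 * L * e) * 1"
        using anderson[of "x - mode" e] measure_ball_pos[OF e] by (intro mult_left_mono) simp_all
      then have "measure post (ball x e) / measure post (ball mode e) \<le> exp (2 * L * e)"
        using measure_post_ball_ratio[OF e, of "x - mode"] by simp
      then show "measure post (ball x e) \<le> exp (2 * L * e) * measure post (ball mode e)"
        using measure_post_ball_mode_pos[OF e] by (simp add: divide_le_eq)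
    qed simp
    moreover have "measure post (ball mode e) \<le> ?s e"
      by (intro cSUP_upper bdd_above_post) simp
    ultimately show ?case
      using measure_post_ball_mode_pos[OF e] by (simp add: exp_minus field_simps)
  qed
  show "eventually (\<lambda>e. measure post (ball mode e) / ?s e \<le> 1) (at_right 0)"
    using eventually_at_right_less[of "0::real"]
  proof eventually_elim
    case (elim e)
    have "measure post (ball mode e) \<le> ?s e"
      by (intro cSUP_upper bdd_above_post) simp
    then show ?case
      using measure_post_ball_mode_pos[OF elim] by simp
  qed
  have "((\<lambda>e. exp (- (2 * L * e))) \<longlongrightarrow> exp (- (2 * L * 0))) (at_right 0)"
    by (intro tendsto_intros)
  then show "((\<lambda>e. exp (- (2 * L * e))) \<longlongrightarrow> 1) (at_right 0)" by simp
qed simp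

lemma strong_mode_unique:
  assumes "strong_mode post z"
  shows "z = mode"
proof (rule ccontr)
  assume "z \<noteq> mode"
  define x where "x = z - mode"
  obtain j where j: "x \<bullet> \<phi> j \<noteq> 0"
    using coord_eqI[of x 0] \<open>z \<noteq> mode\<close> by (auto simp: x_def)
  \<comment> \<open>\<open>Suc j\<close> terms include the nonzero coordinate \<open>j\<close>. A
    finite sum suffices for a limit below \<open>1\<close> and avoids asking whether
    \<open>x\<close> is a Cameron--Martin vector.\<close>
  define s where "s = (\<Sum>k<Suc j. (x \<bullet> \<phi> k)\<^sup>2 / \<nu> k)"
  have "s > 0"
    unfolding s_def using j \<nu>_pos by (intro sum_pos2[of _ j]) (auto simp: less_imp_le)
  let ?b = "\<lambda>e. exp (2 * L * e) * exp (e * norm (preimage (Suc j) x) - s / 2)"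
  have "(?b \<longlongrightarrow> exp (2 * L * 0) * exp (0 * norm (preimage (Suc j) x) - s / 2)) (at_right 0)"
    by (intro tendsto_intros)
  moreover have "eventually (\<lambda>e. measure post (ball z e) / (SUP x. measure post (ball x e)) \<le> ?b e) (at_right 0)"
    using eventually_at_right_less[of "0::real"]
  proof eventually_elim
    case (elim e)
    then have e: "e > 0" .
    have "measure post (ball mode e) \<le> (SUP x. measure post (ball x e))"
      by (intro cSUP_upper bdd_above_post) simp
    then have "measure post (ball z e) / (SUP x. measure post (ball x e)) \<le>
        measure post (ball z e) / measure post (ball mode e)"
      using measure_post_ball_mode_pos[OF e] by (intro divide_left_mono) simp_all
    also have "\<dots> \<le> exp (2 * L * e) * (measure \<mu> (ball x e) / measure \<mu> (ball 0 e))"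
      using measure_post_ball_ratio[OF e, of x] by (simp add: x_def)
    also have "\<dots> \<le> ?b e"
      using measure_ball_upper[of x e "Suc j"] measure_ball_pos[OF e]
      by (intro mult_left_mono) (simp_all only: s_def pos_divide_le_eq exp_ge_zero)
    finally show ?case .
  qed
  ultimately have "1 \<le> exp (2 * L * 0) * exp (0 * norm (preimage (Suc j) x) - s / 2)"
    using assms unfolding strong_mode_def
    by (intro tendsto_le[where F = "at_right (0::real)"]) (auto simp: trivial_limit_at_right_real)
  then show False using \<open>s > 0\<close> by simp
qed

end

subsection \<open>Powers of the operator\<close>

lemma powr_mult_power2:
  fixes a s t :: real
  shows "(a powr s * t)\<^sup>2 = a powr (2 * s) * t\<^sup>2"
proof -
  have "a powr (2 * s) = (a powr s)\<^sup>2"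
    by (simp add: power2_eq_square flip: powr_add)
  then show ?thesis by (simp add: power_mult_distrib)
qed

context hilbert_basis
begin

text \<open>Square summability makes the series in \<open>A_pow\<close> converge, so that its
  \<open>suminf\<close> is an actual sum and not a default value.\<close>

lemma A_pow_coord:
  assumes "summable (\<lambda>k. \<alpha> k powr (2 * s) * (x \<bullet> \<phi> k)\<^sup>2)"
  shows "A_pow \<phi> \<alpha> s x \<bullet> \<phi> k = \<alpha> k powr s * (x \<bullet> \<phi> k)"
proof -
  have "summable (\<lambda>k. (\<alpha> k powr s * (x \<bullet> \<phi> k))\<^sup>2)"
    using assms by (simp add: powr_mult_power2)
  then obtain z where "(\<lambda>k. (\<alpha> k powr s * (x \<bullet> \<phi> k)) *\<^sub>R \<phi> k) sums z"
    and z: "\<And>k. z \<bullet> \<phi> k = \<alpha> k powr s * (x \<bullet> \<phi> k)"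
    using riesz_fischer[of "\<lambda>k. \<alpha> k powr s * (x \<bullet> \<phi> k)"] by blast
  then have "A_pow \<phi> \<alpha> s x = z"
    unfolding A_pow_def by (simp add: sums_iff)
  with z show ?thesis by simp
qed

lemma Xs_norm_eq:
  assumes "x \<in> Xs \<phi> \<alpha> s"
  shows "(Xs_norm \<phi> \<alpha> s x)\<^sup>2 = (\<Sum>k. \<alpha> k powr s * (x \<bullet> \<phi> k)\<^sup>2)"
proof -
  have "A_pow \<phi> \<alpha> (s / 2) x \<bullet> \<phi> k = \<alpha> k powr (s / 2) * (x \<bullet> \<phi> k)" for k
    using assms by (intro A_pow_coord) (simp add: Xs_def)
  then have "(A_pow \<phi> \<alpha> (s / 2) x \<bullet> \<phi> k)\<^sup>2 = \<alpha> k powr s * (x \<bullet> \<phi> k)\<^sup>2" for k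
    by (simp add: powr_mult_power2)
  then show ?thesis
    using sums_unique[OF parseval[of "A_pow \<phi> \<alpha> (s / 2) x"]] by (simp add: Xs_norm_def)
qed

end

text \<open>From \<open>x / p \<le> exp (x / p)\<close>, raised to the power \<open>p\<close>. The
  constant is not optimal, but only finiteness matters.\<close>

lemma powr_mult_exp_neg_le:
  fixes x p :: real
  assumes "x > 0" "p > 0"
  shows "x powr p * exp (- x) \<le> p powr p"
proof -
  have "x powr p = p powr p * (x / p) powr p"
    using assms by (simp flip: powr_mult)
  also have "\<dots> \<le> p powr p * exp (x / p) powr p"
  proof (intro mult_left_mono powr_mono2)
    show "x / p \<le> exp (x / p)"
      using exp_ge_add_one_self[of "x / p"] by linarith
  qed (use assms in simp_all)
  also have "exp (x / p) powr p = exp x"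
    using assms by (simp add: exp_powr_real)
  finally show ?thesis
    by (simp add: exp_minus divide_le_eq flip: divide_inverse)
qed

lemma summable_powr_mult_exp_neg:
  fixes \<alpha> :: "nat \<Rightarrow> real"
  assumes "d \<ge> 1" "C > 0" "p > 0" and \<alpha>: "\<And>k. C * real (Suc k) powr (2 / real d) \<le> \<alpha> k"
  shows "summable (\<lambda>k. \<alpha> k powr p * exp (- \<alpha> k))"
proof (rule summable_comparison_test')
  \<comment> \<open>The extra exponent \<open>real d\<close> pays for
    \<open>\<alpha> k powr - real d\<close>, which the growth \<open>k powr (2 / d)\<close> turns
    into an inverse square.\<close>
  let ?q = "p + real d"
  show "summable (\<lambda>k. (?q powr ?q * C powr - real d) * inverse ((real (Suc k))\<^sup>2))"
    by (intro summable_mult summable_Suc_iff[THEN iffD2] inverse_power_summable) simp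
  fix k
  have pos: "0 < C * real (Suc k) powr (2 / real d)"
    using assms by simp
  then have \<alpha>_pos: "\<alpha> k > 0" using \<alpha>[of k] by linarith
  have "\<alpha> k powr p * exp (- \<alpha> k) = (\<alpha> k powr ?q * exp (- \<alpha> k)) * \<alpha> k powr - real d"
    using \<alpha>_pos by (simp add: mult.assoc mult.commute[of "exp _"] flip: powr_add)
  also have "\<dots> \<le> ?q powr ?q * (C * real (Suc k) powr (2 / real d)) powr - real d"
  proof (rule mult_mono)
    show "\<alpha> k powr ?q * exp (- \<alpha> k) \<le> ?q powr ?q"
      using \<alpha>_pos \<open>p > 0\<close> by (intro powr_mult_exp_neg_le) simp_all
    show "\<alpha> k powr - real d \<le> (C * real (Suc k) powr (2 / real d)) powr - real d"
      by (rule powr_mono2'[OF _ pos \<alpha>]) simp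
  qed simp_all
  also have "(C * real (Suc k) powr (2 / real d)) powr - real d = C powr - real d * inverse ((real (Suc k))\<^sup>2)"
    using assms by (simp add: powr_mult powr_powr powr_minus powr_numeral)
  finally show "norm (\<alpha> k powr p * exp (- \<alpha> k)) \<le> (?q powr ?q * C powr - real d) * inverse ((real (Suc k))\<^sup>2)"
    by (simp add: mult.assoc)
qed

lemma closest_point_Icc:
  fixes a b x :: real
  assumes "a \<le> b"
  shows "closest_point {a..b} x = max a (min b x)"
proof (rule closest_point_unique[symmetric])
  show "max a (min b x) \<in> {a..b}" using assms by auto
  show "\<forall>z\<in>{a..b}. dist x (max a (min b x)) \<le> dist x z"
    using assms by (auto simp: dist_real_def)
qed auto

theorem theorem4p6:
  fixes \<phi> :: "nat \<Rightarrow> 'a::{real_inner, polish_space}"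
    and \<alpha> :: "nat \<Rightarrow> real"
    and d :: nat
    and C_lo C_up b r \<beta> \<tau> :: real
    and \<mu>0 :: "'a measure"
    and y :: 'a
  assumes "orthonormal_basis \<phi>"
    and "d \<ge> 1"
    and "C_lo > 0" and "C_up > 0"
    and "\<And>k. \<alpha> k > 0" and "mono \<alpha>"
    and "\<And>k. C_lo * real (Suc k) powr (2 / real d) \<le> \<alpha> k"
    and "\<And>k. \<alpha> k \<le> C_up * real (Suc k) powr (2 / real d)"
    and "b > 0" and "r > 0"
    and "\<beta> > real d / 2" and "\<tau> > real d / 2"
    and "centered_gaussian (\<lambda>x. r\<^sup>2 *\<^sub>R A_pow \<phi> \<alpha> (- \<tau>) x) \<mu>0"
  shows "prob_space (posterior \<phi> \<alpha> b \<beta> \<mu>0 y) \<and>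
    (\<forall>u\<in>Xs \<phi> \<alpha> \<tau>. I_post \<phi> \<alpha> b \<beta> r \<tau> y u =
       sqrt 2 / b * (\<Sum>k. (\<bar>y \<bullet> \<phi> k - exp (- \<alpha> k) * (u \<bullet> \<phi> k)\<bar> - \<bar>y \<bullet> \<phi> k\<bar>)
                            / \<alpha> k powr (- \<beta> / 2))
       + 1 / (2 * r\<^sup>2) * (\<Sum>k. \<bar>u \<bullet> \<phi> k\<bar>\<^sup>2 / \<alpha> k powr (- \<tau>))) \<and>
    onsager_machlup (posterior \<phi> \<alpha> b \<beta> \<mu>0 y) (Xs \<phi> \<alpha> \<tau>) (I_post \<phi> \<alpha> b \<beta> r \<tau> y) \<and>
    (\<exists>u'. {u. is_arg_min (I_post \<phi> \<alpha> b \<beta> r \<tau> y) (\<lambda>u. u \<in> Xs \<phi> \<alpha> \<tau>) u} = {u'} \<and>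
          {u. strong_mode (posterior \<phi> \<alpha> b \<beta> \<mu>0 y) u} = {u'} \<and>
          (\<lambda>k. (exp (\<alpha> k) *
                  closest_point {- (r\<^sup>2 / b * R_thr \<alpha> \<beta> \<tau> k) .. r\<^sup>2 / b * R_thr \<alpha> \<beta> \<tau> k} (y \<bullet> \<phi> k)) *\<^sub>R \<phi> k)
            sums u')"
proof -
  interpret hilbert_basis \<phi>
    by unfold_locales fact
  note \<alpha>_pos = assms(5)
  define \<nu> where "\<nu> k = r\<^sup>2 * \<alpha> k powr (- \<tau>)" for k
  define c where "c k = sqrt 2 / b * (\<alpha> k powr (\<beta> / 2) * exp (- \<alpha> k))" for k
  define \<eta> where "\<eta> k = exp (\<alpha> k) * (y \<bullet> \<phi> k)" for k
  let ?C = "\<lambda>x. r\<^sup>2 *\<^sub>R A_pow \<phi> \<alpha> (- \<tau>) x" and ?B = "r\<^sup>2 * \<alpha> 0 powr (- \<tau>)"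
  have d: "real d > 0" using assms(2) by simp
  have \<tau>: "\<tau> > 0" and \<beta>: "\<beta> > 0"
    using assms(11,12) d by linarith+
  have powr_le: "\<alpha> k powr (- \<tau>) \<le> \<alpha> 0 powr (- \<tau>)" for k
    using \<tau> \<alpha>_pos \<open>mono \<alpha>\<close> by (intro powr_mono2') (auto simp: mono_def)
  interpret laplace_posterior \<phi> ?C \<nu> \<mu>0 c \<eta> ?B
  proof unfold_locales
    show "centered_gaussian ?C \<mu>0" by fact
    show "?C h \<bullet> \<phi> k = \<nu> k * (h \<bullet> \<phi> k)" for h k
    proof -
      \<comment> \<open>The power is negative and \<open>\<alpha>\<close> non-decreasing, so the
        factors are largest at index \<open>0\<close>; hence \<open>A_pow\<close> with exponent
        \<open>- \<tau>\<close> is meaningful on the whole space.\<close>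
      have "summable (\<lambda>k. \<alpha> k powr (2 * - \<tau>) * (h \<bullet> \<phi> k)\<^sup>2)"
      proof (rule summable_comparison_test')
        show "summable (\<lambda>k. (\<alpha> 0 powr (- \<tau>))\<^sup>2 * (h \<bullet> \<phi> k)\<^sup>2)"
          by (intro summable_mult sums_summable[OF parseval])
        fix k
        have "\<alpha> k powr (2 * - \<tau>) = (\<alpha> k powr (- \<tau>))\<^sup>2"
          by (simp add: power2_eq_square flip: powr_add)
        also have "\<dots> \<le> (\<alpha> 0 powr (- \<tau>))\<^sup>2"
          using powr_le by (intro power_mono) simp_all
        finally show "norm (\<alpha> k powr (2 * - \<tau>) * (h \<bullet> \<phi> k)\<^sup>2) \<le> (\<alpha> 0 powr (- \<tau>))\<^sup>2 * (h \<bullet> \<phi> k)\<^sup>2"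
          by (simp add: mult_right_mono)
      qed
      then show ?thesis
        by (simp add: A_pow_coord \<nu>_def)
    qed
    show "\<nu> k > 0" for k
      using \<alpha>_pos[of k] \<open>r > 0\<close> by (simp add: \<nu>_def)
    show "c k \<ge> 0" for k
      using \<open>b > 0\<close> by (simp add: c_def)
    show "summable c"
      unfolding c_def using \<beta> assms(2,3,7)
      by (intro summable_mult summable_powr_mult_exp_neg[of d C_lo]) simp_all
    show "\<nu> k \<le> ?B" for k
      using powr_le[of k] by (simp add: \<nu>_def mult_left_mono)
  qed
  let ?t = "\<lambda>u k. \<bar>y \<bullet> \<phi> k - exp (- \<alpha> k) * (u \<bullet> \<phi> k)\<bar> - \<bar>y \<bullet> \<phi> k\<bar>"
  have term_eq: "c k * (\<bar>\<eta> k - u \<bullet> \<phi> k\<bar> - \<bar>\<eta> k\<bar>) = sqrt 2 / b * (?t u k / \<alpha> k powr (- \<beta> / 2))" for u k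
  proof -
    have "exp (- \<alpha> k) * \<bar>\<eta> k - u \<bullet> \<phi> k\<bar> = \<bar>exp (- \<alpha> k) * (\<eta> k - u \<bullet> \<phi> k)\<bar>"
      by (simp add: abs_mult)
    also have "exp (- \<alpha> k) * (\<eta> k - u \<bullet> \<phi> k) = y \<bullet> \<phi> k - exp (- \<alpha> k) * (u \<bullet> \<phi> k)"
      by (simp add: \<eta>_def right_diff_distrib mult.assoc[symmetric] mult_exp_exp)
    finally have 1: "exp (- \<alpha> k) * \<bar>\<eta> k - u \<bullet> \<phi> k\<bar> = \<bar>y \<bullet> \<phi> k - exp (- \<alpha> k) * (u \<bullet> \<phi> k)\<bar>" .
    have "exp (- \<alpha> k) * \<bar>\<eta> k\<bar> = \<bar>exp (- \<alpha> k) * \<eta> k\<bar>"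
      by (simp add: abs_mult)
    also have "exp (- \<alpha> k) * \<eta> k = y \<bullet> \<phi> k"
      by (simp add: \<eta>_def mult.assoc[symmetric] mult_exp_exp)
    finally have 2: "exp (- \<alpha> k) * \<bar>\<eta> k\<bar> = \<bar>y \<bullet> \<phi> k\<bar>" .
    have "c k * (\<bar>\<eta> k - u \<bullet> \<phi> k\<bar> - \<bar>\<eta> k\<bar>) =
        sqrt 2 / b * \<alpha> k powr (\<beta> / 2) * (exp (- \<alpha> k) * \<bar>\<eta> k - u \<bullet> \<phi> k\<bar> - exp (- \<alpha> k) * \<bar>\<eta> k\<bar>)"
      by (simp add: c_def right_diff_distrib mult.assoc)
    also have "\<dots> = sqrt 2 / b * (?t u k / \<alpha> k powr (- \<beta> / 2))"
    proof -
      have "\<alpha> k powr (- \<beta> / 2) = inverse (\<alpha> k powr (\<beta> / 2))"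
        using powr_minus[of "\<alpha> k" "\<beta> / 2"] by simp
      then show ?thesis
        unfolding 1 2 by (simp only: divide_inverse inverse_inverse_eq mult_ac)
    qed
    finally show ?thesis .
  qed
  have t_summable: "summable (\<lambda>k. ?t u k / \<alpha> k powr (- \<beta> / 2))" for u
  proof -
    have "sqrt 2 / b \<noteq> 0" using \<open>b > 0\<close> by simp
    then show ?thesis
      using V_summable[of u] by (simp only: term_eq summable_cmult_iff simp_thms)
  qed
  have V_eq: "V u = sqrt 2 / b * (\<Sum>k. ?t u k / \<alpha> k powr (- \<beta> / 2))" for u
    unfolding V_def term_eq by (intro suminf_mult t_summable)
  have Phi_eq: "Phi \<phi> \<alpha> b \<beta> u y = V u" for u
  proof -
    have "(\<Sum>k. ?t u k / (b * \<alpha> k powr (- \<beta> / 2))) = (\<Sum>k. 1 / b * (?t u k / \<alpha> k powr (- \<beta> / 2)))"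
      by simp
    also have "\<dots> = 1 / b * (\<Sum>k. ?t u k / \<alpha> k powr (- \<beta> / 2))"
      by (intro suminf_mult t_summable)
    finally show ?thesis
      unfolding Phi_def V_eq by simp
  qed
  have post_eq: "posterior \<phi> \<alpha> b \<beta> \<mu>0 y = post"
    by (simp add: posterior_def post_def Z_post_def Z_def Phi_eq)
  have quadratic: "(u \<bullet> \<phi> k)\<^sup>2 / \<nu> k = 1 / r\<^sup>2 * (\<alpha> k powr \<tau> * (u \<bullet> \<phi> k)\<^sup>2)" for u k
    by (simp add: \<nu>_def powr_minus field_simps)
  have Xs_eq: "Xs \<phi> \<alpha> \<tau> = {u. summable (\<lambda>k. (u \<bullet> \<phi> k)\<^sup>2 / \<nu> k)}"
    unfolding Xs_def quadratic using \<open>r > 0\<close> by (subst summable_cmult_iff) simp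
  \<comment> \<open>Restricted to \<open>Xs\<close>: elsewhere the series of the quadratic part
    diverges and neither side has a meaningful value.\<close>
  have I_eq: "I_post \<phi> \<alpha> b \<beta> r \<tau> y u = J u" if "u \<in> Xs \<phi> \<alpha> \<tau>" for u
  proof -
    have "summable (\<lambda>k. \<alpha> k powr \<tau> * (u \<bullet> \<phi> k)\<^sup>2)"
      using that by (simp add: Xs_def)
    then have "(\<Sum>k. (u \<bullet> \<phi> k)\<^sup>2 / \<nu> k) = 1 / r\<^sup>2 * (Xs_norm \<phi> \<alpha> \<tau> u)\<^sup>2"
      unfolding quadratic Xs_norm_eq[OF that] by (rule suminf_mult)
    then show ?thesis
      by (simp add: I_post_def J_def Phi_eq)
  qed
  have mode_sums: "(\<lambda>k. (exp (\<alpha> k) *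
      closest_point {- (r\<^sup>2 / b * R_thr \<alpha> \<beta> \<tau> k) .. r\<^sup>2 / b * R_thr \<alpha> \<beta> \<tau> k} (y \<bullet> \<phi> k)) *\<^sub>R \<phi> k) sums mode"
  proof -
    have "exp (\<alpha> k) * closest_point {- (r\<^sup>2 / b * R_thr \<alpha> \<beta> \<tau> k) .. r\<^sup>2 / b * R_thr \<alpha> \<beta> \<tau> k} (y \<bullet> \<phi> k) =
        mode_coord k" for k
    proof -
      let ?\<rho> = "r\<^sup>2 / b * R_thr \<alpha> \<beta> \<tau> k"
      have "?\<rho> \<ge> 0" using \<open>b > 0\<close> by (simp add: R_thr_def)
      then have "closest_point {- ?\<rho> .. ?\<rho>} (y \<bullet> \<phi> k) = max (- ?\<rho>) (min ?\<rho> (y \<bullet> \<phi> k))"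
        by (intro closest_point_Icc) simp
      \<comment> \<open>Scaling by the positive factor \<open>exp (\<alpha> k)\<close> commutes with
        clamping; it carries the data coordinate to \<open>\<eta> k\<close> and the interval bound
        to \<open>\<nu> k * c k\<close>.\<close>
      moreover have "exp (\<alpha> k) * ?\<rho> = \<nu> k * c k"
      proof -
        have "\<alpha> k powr (\<beta> / 2 - \<tau>) = \<alpha> k powr (- \<tau>) * \<alpha> k powr (\<beta> / 2)"
          by (simp flip: powr_add)
        moreover have "exp (- 2 * \<alpha> k) = exp (- \<alpha> k) * exp (- \<alpha> k)"
          by (simp add: mult_exp_exp)
        ultimately show ?thesis
          by (simp add: R_thr_def \<nu>_def c_def exp_minus)
      qed
      ultimately show ?thesis
        by (simp add: mode_coord_def \<eta>_def max_mult_distrib_left min_mult_distrib_left)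
    qed
    then show ?thesis
      using sums_coord[of mode] by (simp add: mode_coord_eq)
  qed
  show ?thesis
    unfolding post_eq
  proof (intro conjI exI[of _ mode] ballI)
    show "prob_space post" by (rule prob_space_post)
  next
    fix u assume u: "u \<in> Xs \<phi> \<alpha> \<tau>"
    show "I_post \<phi> \<alpha> b \<beta> r \<tau> y u = sqrt 2 / b * (\<Sum>k. ?t u k / \<alpha> k powr (- \<beta> / 2))
        + 1 / (2 * r\<^sup>2) * (\<Sum>k. \<bar>u \<bullet> \<phi> k\<bar>\<^sup>2 / \<alpha> k powr (- \<tau>))"
    proof -
      have "\<bar>u \<bullet> \<phi> k\<bar>\<^sup>2 / \<alpha> k powr (- \<tau>) = \<alpha> k powr \<tau> * (u \<bullet> \<phi> k)\<^sup>2" for k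
        by (simp add: powr_minus_divide)
      then show ?thesis
        by (simp only: I_post_def Phi_eq V_eq Xs_norm_eq[OF u])
    qed
  next
    have "onsager_machlup post (Xs \<phi> \<alpha> \<tau>) J"
      using onsager_machlup_post by (simp only: Xs_eq)
    then show "onsager_machlup post (Xs \<phi> \<alpha> \<tau>) (I_post \<phi> \<alpha> b \<beta> r \<tau> y)"
      by (simp add: onsager_machlup_def I_eq)
  next
    have "is_arg_min (I_post \<phi> \<alpha> b \<beta> r \<tau> y) (\<lambda>u. u \<in> Xs \<phi> \<alpha> \<tau>) u \<longleftrightarrow> is_arg_min J (\<lambda>u. u \<in> Xs \<phi> \<alpha> \<tau>) u" for u
      by (auto simp: is_arg_min_def I_eq)
    then show "{u. is_arg_min (I_post \<phi> \<alpha> b \<beta> r \<tau> y) (\<lambda>u. u \<in> Xs \<phi> \<alpha> \<tau>) u} = {mode}"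
      using arg_min_J by (simp only: Xs_eq mem_Collect_eq)
  next
    show "{u. strong_mode post u} = {mode}"
      using strong_mode_mode strong_mode_unique by blast
  qed (rule mode_sums)
qed

end
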